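(* Let $0<\theta\le 1$ and $\lambda_{\mathrm{alg}}>0$ be arbitrary. Then the adaptive algorithm described in the context (AFEM) guarantees the existence of constants $C_{\mathrm{lin}}>0$ and $0<q_{\mathrm{lin}}<1$ such that $$\mathrm{H}_\ell^k\le C_{\mathrm{lin}}\,q_{\mathrm{lin}}^{|\ell,k|-|\ell',k'|}\,\mathrm{H}_{\ell'}^{k'}\quad\text{for all }(\ell,k),(\ell',k')\in\mathcal Q\text{ with }|\ell,k|>|\ell',k'|.$$ In particular, this yields convergence $$\|u^\star-u_\ell^k\|_a\lesssim \mathrm{H}_\ell^k\le C_{\mathrm{lin}}\,q_{\mathrm{lin}}^{|\ell,k|}\,\mathrm{H}_0^0\to 0\quad\text{as }|\ell,k|\to\infty.$$
   Context: **Model problem.** $\Omega\subset\mathbb{R}^d$ ($d\in\mathbb N$) is a bounded Lipschitz domain with polytopal boundary, $\mathcal X:=H^1_0(\Omega)$, $\boldsymbol A\in[L^\infty(\Omega)]^{d\times d}$ is symmetric with $0<\operatorname{ess\,inf}_x\lambda_{\min}(\boldsymbol A(x))\le\operatorname{ess\,sup}_x\lambda_{\max}(\boldsymbol A(x))<\infty$, $f\in L^2(\Omega)$, $\boldsymbol f\in[L^2(\Omega)]^d$. Put $a(u,v):=\int_\Omega \boldsymbol A\nabla u\cdot\nabla v\,dx$, $F(v):=\int_\Omega (fv+\boldsymbol f\cdot\nabla v)\,dx$, and $\|v\|_a:=a(v,v)^{1/2}$ (energy norm). The exact solution $u^\star\in\mathcal X$ satisfies $a(u^\star,v)=F(v)$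 for all $v\in\mathcal X$. **Meshes and refinement.** $\mathcal T_0$ is a conforming simplicial mesh of $\Omega$, admissible for newest-vertex bisection (NVB). For a mesh $\mathcal T_H$ and $\mathcal M_H\subseteq\mathcal T_H$, $\mathtt{refine}(\mathcal T_H,\mathcal M_H)$ is the coarsest conforming NVB refinement of $\mathcal T_H$ in which at least all elements of $\mathcal M_H$ are bisected; $\mathtt{refine}(\mathcal T_H)$ is the set of all meshes obtainable from $\mathcal T_H$ by finitely many (possibly zero) such steps; $\mathbb T:=\mathtt{refine}(\mathcal T_0)$. All meshes in $\mathbb T$ are uniformly shape regular. For a fixed polynomial degree $p\in\mathbb N$, $\mathcal X_H:=\{v_H\in\mathcal X: v_H|_T\text{ polynomial of degree}\le p\ \forall T\in\mathcal T_H\}$, and $u_H^\star\in\mathcal X_H$ is the exact discrete solution, $a(u_H^\star,v_H)=F(v_H)$ for all $v_H\in\mathcal X_H$. Indices of meshes are inherited by associated objects (e.g. $\mathcal T_\ell,\mathcal X_\ell,u_\ell^\star,\eta_\ell,\Psi_\ell$). **Algebraic solver.** For each $\mathcal T_H\in\mathbb T$, one solver step is a map $\Psi_H(F;\cdot):\mathcal X_H\to\mathcal X_H$; the iterates $u_H^k:=\Psi_H(F;u_H^{k-1})$ satisfy $\|u_H^\star-u_H^k\|_a\le q_{\mathrm{alg}}\|u_H^\star-u_H^{k-1}\|_a$ with a uniform constant $0<q_{\mathrm{alg}}<1$ (independent of the mesh, of $k$, and of the initial iterate). **Error estimator.** $\boldsymbol A|_T$ and $\boldsymbol f|_T$ are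 Lipschitz continuous on each $T\in\mathcal T_0$ (hence on each element of each mesh in $\mathbb T$). For $v_H\in\mathcal X_H$, $\eta_H(T,v_H)^2:=|T|^{2/d}\|f+\operatorname{div}(\boldsymbol A\nabla v_H-\boldsymbol f)\|_{L^2(T)}^2+|T|^{1/d}\|[\![(\boldsymbol A\nabla v_H-\boldsymbol f)\cdot n]\!]\|_{L^2(\partial T\cap\Omega)}^2$ ($[\![\cdot]\!]$ the jump across interior faces), $\eta_H(\mathcal U_H,v_H):=(\sum_{T\in\mathcal U_H}\eta_H(T,v_H)^2)^{1/2}$ for $\mathcal U_H\subseteq\mathcal T_H$, $\eta_H(v_H):=\eta_H(\mathcal T_H,v_H)$. This estimator is known to satisfy, with constants $C_{\mathrm{stab}},C_{\mathrm{rel}},C_{\mathrm{drel}}>0$ and $0<q_{\mathrm{red}}<1$, for all $\mathcal T_H\in\mathbb T$ and $\mathcal T_h\in\mathtt{refine}(\mathcal T_H)$: (A1) stability: $|\eta_h(\mathcal U_H,v_h)-\eta_H(\mathcal U_H,v_H)|\le C_{\mathrm{stab}}\|v_h-v_H\|_a$ for all $v_h\in\mathcal X_h$, $v_H\in\mathcal X_H$, $\mathcal U_H\subseteq\mathcal T_H\cap\mathcal T_h$; (A2) reduction: $\eta_h(\mathcal T_h\setminus\mathcal T_H,v_H)\le q_{\mathrm{red}}\,\eta_H(\mathcal T_H\setminus\mathcal T_h,v_H)$ for all $v_H\in\mathcal X_H$; (A3) reliability: $\|u^\star-u_H^\star\|_a\le C_{\mathrm{rel}}\,\eta_H(u_H^\star)$;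 (A4) discrete reliability: $\|u_h^\star-u_H^\star\|_a\le C_{\mathrm{drel}}\,\eta_H(\mathcal T_H\setminus\mathcal T_h,u_H^\star)$. **Adaptive algorithm (AFEM).** Input: $\mathcal T_0$, $p$, $u_0^0:=0$, marking parameter $0<\theta\le1$, solver parameter $\lambda_{\mathrm{alg}}>0$. For $\ell=0,1,2,\dots$: (I) for $k=1,2,3,\dots$ compute $u_\ell^k:=\Psi_\ell(F;u_\ell^{k-1})$ and the indicators $\eta_\ell(T,u_\ell^k)$, and stop the $k$-loop with $\underline k[\ell]:=k$ as soon as $\|u_\ell^k-u_\ell^{k-1}\|_a\le\lambda_{\mathrm{alg}}\,\eta_\ell(u_\ell^k)$; (II) choose $\mathcal M_\ell\subseteq\mathcal T_\ell$ of minimal cardinality with $\theta\,\eta_\ell(u_\ell^{\underline k})^2\le\eta_\ell(\mathcal M_\ell,u_\ell^{\underline k})^2$ (Dörfler marking); (III) set $\mathcal T_{\ell+1}:=\mathtt{refine}(\mathcal T_\ell,\mathcal M_\ell)$ and $u_{\ell+1}^0:=u_\ell^{\underline k}$. (The $k$-loop may fail to terminate for some $\ell$; then $\underline k[\ell]=\infty$ and no further levels are generated.) Here $\underline k=\underline k[\ell]$ in $u_\ell^{\underline k}$. **Index set and quasi-error.** $\mathcal Q:=\{(\ell,k)\in\mathbb N_0^2: u_\ell^k\text{ is defined in the algorithm}\}$, ordered by $(\ell',k')\le(\ell,k)$ iff $u_{\ell'}^{k'}$ is used no later than $u_\ell^k$ in the algorithm (i.e. lexicographically); $|\ell,k|:=\#\{(\ell',k')\in\mathcal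 Q:(\ell',k')\le(\ell,k)\}$. The quasi-error is $\mathrm H_\ell^k:=\|u_\ell^\star-u_\ell^k\|_a+\eta_\ell(u_\ell^k)$ for $(\ell,k)\in\mathcal Q$. $A\lesssim B$ means $A\le C\,B$ with a constant $C>0$ independent of the mesh size and of the indices $\ell,k$ (it may depend on $\mathcal T_0$, the shape regularity, the data $\boldsymbol A,f,\boldsymbol f$, and $p$). *)

theory Defs
  imports
    "HOL-Analysis.Analysis"
    "HOL-Probability.Essential_Supremum"
    "HOL-Library.Extended_Nat"
begin

section \<open>Domains\<close>

text \<open>Near every boundary point the domain is the strict subgraph of a Lipschitz function,
  defined on the hyperplane orthogonal to some unit vector \<open>e\<close>.\<close>

definition lipschitz_boundary :: "(real^'n) set \<Rightarrow> bool" where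
  "lipschitz_boundary \<Omega> \<longleftrightarrow>
     (\<forall>x\<in>frontier \<Omega>. \<exists>e r L. \<exists>\<phi> :: real^'n \<Rightarrow> real.
        norm e = 1 \<and> 0 < r \<and> L-lipschitz_on {z. e \<bullet> z = 0} \<phi> \<and>
        (\<forall>y\<in>ball x r. y \<in> \<Omega> \<longleftrightarrow> e \<bullet> (y - x) < \<phi> ((y - x) - (e \<bullet> (y - x)) *\<^sub>R e)))"

definition polytopal_boundary :: "(real^'n) set \<Rightarrow> bool" where
  "polytopal_boundary \<Omega> \<longleftrightarrow> (\<exists>\<P>. finite \<P> \<and> (\<forall>P\<in>\<P>. polytope P) \<and> frontier \<Omega> = \<Union>\<P>)"

definition polytopal_lipschitz_domain :: "(real^'n) set \<Rightarrow> bool" where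
  "polytopal_lipschitz_domain \<Omega> \<longleftrightarrow>
     open \<Omega> \<and> connected \<Omega> \<and> \<Omega> \<noteq> {} \<and> bounded \<Omega> \<and> lipschitz_boundary \<Omega> \<and> polytopal_boundary \<Omega>"


section \<open>Classical derivatives and test functions\<close>

definition partial_deriv :: "'n \<Rightarrow> (real^'n \<Rightarrow> real) \<Rightarrow> real^'n \<Rightarrow> real" where
  "partial_deriv i v x = frechet_derivative v (at x) (axis i 1)"

definition gradient :: "(real^'n \<Rightarrow> real) \<Rightarrow> real^'n \<Rightarrow> real^'n" where
  "gradient v x = (\<chi> i. partial_deriv i v x)"

definition divergence :: "(real^'n \<Rightarrow> real^'n) \<Rightarrow> real^'n \<Rightarrow> real" where
  "divergence \<sigma> x = (\<Sum>i\<in>UNIV. frechet_derivative \<sigma> (at x) (axis i 1) $ i)"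

primrec cont_diff :: "nat \<Rightarrow> (real^'n \<Rightarrow> real) \<Rightarrow> bool" where
  "cont_diff 0 v \<longleftrightarrow> continuous_on UNIV v"
| "cont_diff (Suc k) v \<longleftrightarrow> v differentiable_on UNIV \<and> (\<forall>i. cont_diff k (partial_deriv i v))"

definition test_functions :: "(real^'n) set \<Rightarrow> (real^'n \<Rightarrow> real) set" where
  "test_functions \<Omega> =
     {\<phi>. (\<forall>k. cont_diff k \<phi>) \<and> compact (closure {x. \<phi> x \<noteq> 0}) \<and> closure {x. \<phi> x \<noteq> 0} \<subseteq> \<Omega>}"


section \<open>Lebesgue and Sobolev spaces\<close>

text \<open>Elements of the function spaces are representatives, defined on the whole space; only their
  values on the domain matter, and no identification of almost everywhere equal functions is made.\<close>

definition L2 :: "(real^'n) set \<Rightarrow> (real^'n \<Rightarrow> 'b::real_normed_vector) set" where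
  "L2 \<Omega> = {g. g \<in> borel_measurable (lebesgue_on \<Omega>) \<and> integrable (lebesgue_on \<Omega>) (\<lambda>x. (norm (g x))\<^sup>2)}"

definition is_weak_gradient ::
    "(real^'n) set \<Rightarrow> (real^'n \<Rightarrow> real) \<Rightarrow> (real^'n \<Rightarrow> real^'n) \<Rightarrow> bool" where
  "is_weak_gradient \<Omega> v g \<longleftrightarrow>
     (\<forall>\<phi>\<in>test_functions \<Omega>.
        (LINT x|lebesgue_on \<Omega>. v x *\<^sub>R gradient \<phi> x) = - (LINT x|lebesgue_on \<Omega>. \<phi> x *\<^sub>R g x))"

definition H1 :: "(real^'n) set \<Rightarrow> (real^'n \<Rightarrow> real) set" where
  "H1 \<Omega> = {v \<in> L2 \<Omega>. \<exists>g\<in>L2 \<Omega>. is_weak_gradient \<Omega> v g}"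

text \<open>The weak gradient is unique up to null sets of \<open>\<Omega>\<close>, so the choice is immaterial
  under integrals over \<open>\<Omega>\<close>; pointwise evaluations use \<^const>\<open>gradient\<close> instead.\<close>

definition weak_gradient :: "(real^'n) set \<Rightarrow> (real^'n \<Rightarrow> real) \<Rightarrow> real^'n \<Rightarrow> real^'n" where
  "weak_gradient \<Omega> v = (SOME g. g \<in> L2 \<Omega> \<and> is_weak_gradient \<Omega> v g)"

text \<open>The closure of the test functions in the norm of \<^const>\<open>H1\<close>.\<close>

definition H10 :: "(real^'n) set \<Rightarrow> (real^'n \<Rightarrow> real) set" where
  "H10 \<Omega> = {v \<in> H1 \<Omega>. \<exists>\<phi>. (\<forall>n::nat. \<phi> n \<in> test_functions \<Omega>) \<and>
     (\<lambda>n. LINT x|lebesgue_on \<Omega>. (\<phi> n x - v x)\<^sup>2) \<longlonglongrightarrow> 0 \<and>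
     (\<lambda>n. LINT x|lebesgue_on \<Omega>. (norm (gradient (\<phi> n) x - weak_gradient \<Omega> v x))\<^sup>2) \<longlonglongrightarrow> 0}"


section \<open>The model problem\<close>

definition eigenvalues :: "real^'n^'n \<Rightarrow> real set" where
  "eigenvalues M = {\<mu>. \<exists>v. v \<noteq> 0 \<and> M *v v = \<mu> *\<^sub>R v}"

definition lambda_min :: "real^'n^'n \<Rightarrow> real" where
  "lambda_min M = Min (eigenvalues M)"

definition lambda_max :: "real^'n^'n \<Rightarrow> real" where
  "lambda_max M = Max (eigenvalues M)"

definition essinf :: "'a measure \<Rightarrow> ('a \<Rightarrow> ereal) \<Rightarrow> ereal" where
  "essinf M f = - esssup M (\<lambda>x. - f x)"

definition diffusion_coefficient :: "(real^'n) set \<Rightarrow> (real^'n \<Rightarrow> real^'n^'n) \<Rightarrow> bool" where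
  "diffusion_coefficient \<Omega> A \<longleftrightarrow>
     A \<in> borel_measurable (lebesgue_on \<Omega>) \<and>
     (\<exists>C. AE x in lebesgue_on \<Omega>. norm (A x) \<le> C) \<and>
     (AE x in lebesgue_on \<Omega>. transpose (A x) = A x) \<and>
     0 < essinf (lebesgue_on \<Omega>) (\<lambda>x. ereal (lambda_min (A x))) \<and>
     esssup (lebesgue_on \<Omega>) (\<lambda>x. ereal (lambda_max (A x))) < \<infinity>"

definition energy_form ::
    "(real^'n) set \<Rightarrow> (real^'n \<Rightarrow> real^'n^'n) \<Rightarrow> (real^'n \<Rightarrow> real) \<Rightarrow> (real^'n \<Rightarrow> real) \<Rightarrow> real" where
  "energy_form \<Omega> A u v =
     (LINT x|lebesgue_on \<Omega>. (A x *v weak_gradient \<Omega> u x) \<bullet> weak_gradient \<Omega> v x)"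

definition energy_norm ::
    "(real^'n) set \<Rightarrow> (real^'n \<Rightarrow> real^'n^'n) \<Rightarrow> (real^'n \<Rightarrow> real) \<Rightarrow> real" where
  "energy_norm \<Omega> A v = sqrt (energy_form \<Omega> A v v)"

definition load_functional ::
    "(real^'n) set \<Rightarrow> (real^'n \<Rightarrow> real) \<Rightarrow> (real^'n \<Rightarrow> real^'n) \<Rightarrow> (real^'n \<Rightarrow> real) \<Rightarrow> real" where
  "load_functional \<Omega> f ff v =
     (LINT x|lebesgue_on \<Omega>. f x * v x + ff x \<bullet> weak_gradient \<Omega> v x)"

definition galerkin_solution ::
    "(real^'n) set \<Rightarrow> (real^'n \<Rightarrow> real^'n^'n) \<Rightarrow> ((real^'n \<Rightarrow> real) \<Rightarrow> real) \<Rightarrow>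
     (real^'n \<Rightarrow> real) set \<Rightarrow> (real^'n \<Rightarrow> real) \<Rightarrow> bool" where
  "galerkin_solution \<Omega> A F V u \<longleftrightarrow> u \<in> V \<and> (\<forall>v\<in>V. energy_form \<Omega> A u v = F v)"


section \<open>Newest-vertex bisection\<close>

text \<open>Tagged simplices in the sense of Maubach, Traxler and Stevenson: the ordered list
  \<open>x\<^sub>0, \<dots>, x\<^sub>d\<close> of vertices together with a type \<open>\<gamma> < d\<close>. The refinement edge joins
  \<open>x\<^sub>0\<close> and \<open>x\<^sub>d\<close>. The tags of all later simplices are inherited from the initial mesh, so that
  set operations on meshes of tagged simplices agree with those on the meshes of untagged ones.\<close>

type_synonym 'n tagged_simplex = "(real^'n) list \<times> nat"

definition vertices :: "'n tagged_simplex \<Rightarrow> (real^'n) set" where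
  "vertices T = set (fst T)"

definition elem :: "'n tagged_simplex \<Rightarrow> (real^'n) set" where
  "elem T = convex hull (vertices T)"

definition nondegenerate :: "'n::finite tagged_simplex \<Rightarrow> bool" where
  "nondegenerate T \<longleftrightarrow>
     length (fst T) = CARD('n) + 1 \<and> distinct (fst T) \<and> \<not> affine_dependent (vertices T) \<and>
     snd T < CARD('n)"

text \<open>The children of \<open>(x\<^sub>0, \<dots>, x\<^sub>d)\<close> of type \<open>\<gamma>\<close> are
  \<open>(x\<^sub>0, m, x\<^sub>1, \<dots>, x\<^sub>\<gamma>, x\<^bsub>\<gamma>+1\<^esub>, \<dots>, x\<^bsub>d-1\<^esub>)\<close> and
  \<open>(x\<^sub>d, m, x\<^sub>1, \<dots>, x\<^sub>\<gamma>, x\<^bsub>d-1\<^esub>, \<dots>, x\<^bsub>\<gamma>+1\<^esub>)\<close>, both of type \<open>\<gamma> + 1\<close> modulo \<open>d\<close>,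
  where \<open>m\<close> is the midpoint of \<open>x\<^sub>0\<close> and \<open>x\<^sub>d\<close>.\<close>

definition children :: "'n::finite tagged_simplex \<Rightarrow> 'n tagged_simplex set" where
  "children T =
     (case T of (xs, \<gamma>) \<Rightarrow>
        let m = midpoint (hd xs) (last xs); inner = butlast (tl xs); \<gamma>' = (\<gamma> + 1) mod CARD('n)
        in {(hd xs # m # inner, \<gamma>'),
            (last xs # m # take \<gamma> inner @ rev (drop \<gamma> inner), \<gamma>')})"

text \<open>The same simplex with the other vertex order that produces the same children.\<close>

definition reflection :: "'n tagged_simplex \<Rightarrow> 'n tagged_simplex" where
  "reflection T =
     (case T of (xs, \<gamma>) \<Rightarrow>
        let inner = butlast (tl xs)
        in (last xs # take \<gamma> inner @ rev (drop \<gamma> inner) @ [hd xs], \<gamma>))"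

definition neighbours :: "'n::finite tagged_simplex \<Rightarrow> 'n tagged_simplex \<Rightarrow> bool" where
  "neighbours T T' \<longleftrightarrow> card (vertices T \<inter> vertices T') = CARD('n)"

definition differ_in_one :: "'n::finite tagged_simplex \<Rightarrow> 'n tagged_simplex \<Rightarrow> bool" where
  "differ_in_one T T' \<longleftrightarrow> card {i. i \<le> CARD('n) \<and> fst T ! i \<noteq> fst T' ! i} = 1"

definition reflected_neighbours :: "'n::finite tagged_simplex \<Rightarrow> 'n tagged_simplex \<Rightarrow> bool" where
  "reflected_neighbours T T' \<longleftrightarrow> differ_in_one T T' \<or> differ_in_one (reflection T) T'"

definition refinement_edge :: "'n tagged_simplex \<Rightarrow> (real^'n) set" where
  "refinement_edge T = {hd (fst T), last (fst T)}"

text \<open>Stevenson's matching condition on the initial mesh.\<close>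

definition nvb_admissible :: "'n::finite tagged_simplex set \<Rightarrow> bool" where
  "nvb_admissible \<T> \<longleftrightarrow>
     (\<forall>T\<in>\<T>. \<forall>T'\<in>\<T>. snd T = snd T') \<and>
     (\<forall>T\<in>\<T>. \<forall>T'\<in>\<T>. neighbours T T' \<longrightarrow>
        (if refinement_edge T \<subseteq> vertices T \<inter> vertices T' \<or>
            refinement_edge T' \<subseteq> vertices T \<inter> vertices T'
         then reflected_neighbours T T'
         else \<forall>c\<in>children T. \<forall>c'\<in>children T'. neighbours c c' \<longrightarrow> reflected_neighbours c c'))"

definition conforming :: "'n::finite tagged_simplex set \<Rightarrow> bool" where
  "conforming \<T> \<longleftrightarrow>
     (\<forall>T\<in>\<T>. \<forall>T'\<in>\<T>. elem T \<inter> elem T' = convex hull (vertices T \<inter> vertices T'))"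

text \<open>Injectivity of \<^const>\<open>elem\<close> excludes that one simplex occurs with two different tags.\<close>

definition conforming_mesh :: "(real^'n::finite) set \<Rightarrow> 'n tagged_simplex set \<Rightarrow> bool" where
  "conforming_mesh \<Omega> \<T> \<longleftrightarrow>
     finite \<T> \<and> (\<forall>T\<in>\<T>. nondegenerate T) \<and> inj_on elem \<T> \<and> conforming \<T> \<and>
     (\<Union>T\<in>\<T>. elem T) = closure \<Omega>"

definition bisection_step :: "'n::finite tagged_simplex set \<Rightarrow> 'n tagged_simplex set \<Rightarrow> bool" where
  "bisection_step \<T> \<T>' \<longleftrightarrow> (\<exists>T\<in>\<T>. \<T>' = (\<T> - {T}) \<union> children T)"

abbreviation nvb_refinement :: "'n::finite tagged_simplex set \<Rightarrow> 'n tagged_simplex set \<Rightarrow> bool" where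
  "nvb_refinement \<equiv> rtranclp bisection_step"

definition conforming_refinements ::
    "'n::finite tagged_simplex set \<Rightarrow> 'n tagged_simplex set \<Rightarrow> 'n tagged_simplex set set" where
  "conforming_refinements \<T> \<M> = {\<S>. nvb_refinement \<T> \<S> \<and> conforming \<S> \<and> \<M> \<inter> \<S> = {}}"

text \<open>\<open>is_refine \<T> \<M> \<T>'\<close> stands for \<open>\<T>' = refine(\<T>, \<M>)\<close>.\<close>

definition is_refine :: "'n::finite tagged_simplex set \<Rightarrow> 'n tagged_simplex set \<Rightarrow> 'n tagged_simplex set \<Rightarrow> bool" where
  "is_refine \<T> \<M> \<T>' \<longleftrightarrow>
     \<T>' \<in> conforming_refinements \<T> \<M> \<and>
     (\<forall>\<S>\<in>conforming_refinements \<T> \<M>. nvb_refinement \<T>' \<S>)"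

inductive_set refinements :: "'n::finite tagged_simplex set \<Rightarrow> 'n tagged_simplex set set"
  for \<T> :: "'n tagged_simplex set" where
  refl: "\<T> \<in> refinements \<T>"
| step: "\<T>' \<in> refinements \<T> \<Longrightarrow> \<M> \<subseteq> \<T>' \<Longrightarrow> is_refine \<T>' \<M> \<T>'' \<Longrightarrow> \<T>'' \<in> refinements \<T>"


section \<open>Finite element spaces\<close>

definition polynomial_of_degree_le :: "nat \<Rightarrow> (real^'n::finite \<Rightarrow> real) \<Rightarrow> bool" where
  "polynomial_of_degree_le p q \<longleftrightarrow>
     (\<exists>c :: ('n \<Rightarrow> nat) \<Rightarrow> real.
        \<forall>x. q x = (\<Sum>\<alpha> | (\<Sum>i\<in>UNIV. \<alpha> i) \<le> p. c \<alpha> * (\<Prod>i\<in>UNIV. (x $ i) ^ \<alpha> i)))"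

text \<open>Piecewise polynomial elements of \<^const>\<open>H10\<close> are continuous, hence the representative
  can be required to agree with the polynomials everywhere on the closed elements.\<close>

definition fe_space ::
    "(real^'n::finite) set \<Rightarrow> nat \<Rightarrow> 'n tagged_simplex set \<Rightarrow> (real^'n \<Rightarrow> real) set" where
  "fe_space \<Omega> p \<T> =
     {v \<in> H10 \<Omega>. \<forall>T\<in>\<T>. \<exists>q. polynomial_of_degree_le p q \<and> (\<forall>x\<in>elem T. v x = q x)}"


section \<open>The residual error estimator\<close>

definition lipschitz_on_elements ::
    "'n tagged_simplex set \<Rightarrow> (real^'n \<Rightarrow> 'b::metric_space) \<Rightarrow> bool" where
  "lipschitz_on_elements \<T> g \<longleftrightarrow> (\<forall>T\<in>\<T>. \<exists>L. L-lipschitz_on (interior (elem T)) g)"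

definition flux ::
    "(real^'n \<Rightarrow> real^'n^'n) \<Rightarrow> (real^'n \<Rightarrow> real^'n) \<Rightarrow> (real^'n \<Rightarrow> real) \<Rightarrow> real^'n \<Rightarrow> real^'n" where
  "flux A ff v x = A x *v gradient v x - ff x"

definition trace_from :: "(real^'n) set \<Rightarrow> (real^'n \<Rightarrow> real^'n) \<Rightarrow> real^'n \<Rightarrow> real^'n" where
  "trace_from K \<sigma> x = Lim (at x within interior K) \<sigma>"

definition facet_normal :: "(real^'n) set \<Rightarrow> real^'n" where
  "facet_normal E = (SOME n. norm n = 1 \<and> (\<forall>x\<in>E. \<forall>y\<in>E. n \<bullet> (x - y) = 0))"

text \<open>By Fubini, the surface integral over a facet \<open>E\<close> is the volume integral over the prism
  \<open>E + [0, 1] n\<close> of the integrand extended constantly in the normal direction \<open>n\<close>. On this prism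
  the closest point in \<open>E\<close> is the orthogonal projection. The value is independent of the
  orientation of \<open>n\<close>. In dimension one it is the point evaluation.\<close>

definition facet_integral :: "(real^'n) set \<Rightarrow> (real^'n \<Rightarrow> real) \<Rightarrow> real" where
  "facet_integral E g =
     (LINT x|lebesgue_on {y + t *\<^sub>R facet_normal E | y t. y \<in> E \<and> 0 \<le> t \<and> t \<le> 1}.
        g (closest_point E x))"

text \<open>The elements of the mesh sharing a facet with \<open>T\<close> provide, up to null sets,
  the part of the boundary of \<open>T\<close> inside the domain. The flux is Lipschitz on the interior of each
  element, hence differentiable almost everywhere by Rademacher's theorem.\<close>

definition eta_sq ::
    "(real^'n::finite \<Rightarrow> real^'n^'n) \<Rightarrow> (real^'n \<Rightarrow> real) \<Rightarrow> (real^'n \<Rightarrow> real^'n) \<Rightarrow>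
     'n tagged_simplex set \<Rightarrow> (real^'n \<Rightarrow> real) \<Rightarrow> 'n tagged_simplex \<Rightarrow> real" where
  "eta_sq A f ff \<T> v T =
     measure lebesgue (elem T) powr (2 / CARD('n)) *
       (LINT x|lebesgue_on (elem T). (f x + divergence (flux A ff v) x)\<^sup>2) +
     measure lebesgue (elem T) powr (1 / CARD('n)) *
       (\<Sum>T' | T' \<in> \<T> \<and> neighbours T T'.
          facet_integral (elem T \<inter> elem T')
            (\<lambda>x. ((trace_from (elem T) (flux A ff v) x - trace_from (elem T') (flux A ff v) x)
                  \<bullet> facet_normal (elem T \<inter> elem T'))\<^sup>2))"

definition eta ::
    "(real^'n::finite \<Rightarrow> real^'n^'n) \<Rightarrow> (real^'n \<Rightarrow> real) \<Rightarrow> (real^'n \<Rightarrow> real^'n) \<Rightarrow>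
     'n tagged_simplex set \<Rightarrow> 'n tagged_simplex set \<Rightarrow> (real^'n \<Rightarrow> real) \<Rightarrow> real" where
  "eta A f ff \<T> \<U> v = sqrt (\<Sum>T\<in>\<U>. eta_sq A f ff \<T> v T)"


section \<open>The adaptive algorithm\<close>

definition doerfler_marking ::
    "real \<Rightarrow> 'n tagged_simplex set \<Rightarrow> ('n tagged_simplex set \<Rightarrow> real) \<Rightarrow> 'n tagged_simplex set \<Rightarrow> bool" where
  "doerfler_marking \<theta> \<T> est \<M> \<longleftrightarrow>
     \<M> \<subseteq> \<T> \<and> \<theta> * (est \<T>)\<^sup>2 \<le> (est \<M>)\<^sup>2 \<and>
     (\<forall>\<M>'. \<M>' \<subseteq> \<T> \<and> \<theta> * (est \<T>)\<^sup>2 \<le> (est \<M>')\<^sup>2 \<longrightarrow> card \<M> \<le> card \<M>')"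

text \<open>A run consists of meshes \<open>\<T> l\<close>, marked sets \<open>\<M> l\<close>, iterates \<open>u l k\<close> and final solver
  indices \<open>kk l\<close>, with \<open>kk l = \<infinity>\<close> if the solver loop on level \<open>l\<close> does not terminate
  (note \<open>Inf {} = \<infinity>\<close>). Levels after a nonterminating one and iterates
  beyond \<open>kk l\<close> are not generated, and the values of the sequences there are unconstrained.\<close>

definition level_reached :: "(nat \<Rightarrow> enat) \<Rightarrow> nat \<Rightarrow> bool" where
  "level_reached kk l \<longleftrightarrow> (\<forall>l'<l. kk l' \<noteq> \<infinity>)"

definition afem_run ::
    "(real^'n::finite) set \<Rightarrow> (real^'n \<Rightarrow> real^'n^'n) \<Rightarrow> (real^'n \<Rightarrow> real) \<Rightarrow> (real^'n \<Rightarrow> real^'n) \<Rightarrow>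
     ('n tagged_simplex set \<Rightarrow> ((real^'n \<Rightarrow> real) \<Rightarrow> real) \<Rightarrow> (real^'n \<Rightarrow> real) \<Rightarrow> (real^'n \<Rightarrow> real)) \<Rightarrow>
     'n tagged_simplex set \<Rightarrow> real \<Rightarrow> real \<Rightarrow>
     (nat \<Rightarrow> 'n tagged_simplex set) \<Rightarrow> (nat \<Rightarrow> 'n tagged_simplex set) \<Rightarrow> (nat \<Rightarrow> nat \<Rightarrow> real^'n \<Rightarrow> real) \<Rightarrow>
     (nat \<Rightarrow> enat) \<Rightarrow> bool" where
  "afem_run \<Omega> A f ff \<Psi> \<T>\<^sub>0 \<theta> lam \<T> \<M> u kk \<longleftrightarrow>
     \<T> 0 = \<T>\<^sub>0 \<and> u 0 0 = (\<lambda>x. 0) \<and>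
     (\<forall>l. level_reached kk l \<longrightarrow>
        (\<forall>k. enat (Suc k) \<le> kk l \<longrightarrow>
           u l (Suc k) = \<Psi> (\<T> l) (load_functional \<Omega> f ff) (u l k)) \<and>
        kk l = Inf (enat ` {k. 1 \<le> k \<and>
           energy_norm \<Omega> A (u l k - u l (k - 1)) \<le> lam * eta A f ff (\<T> l) (\<T> l) (u l k)}) \<and>
        (\<forall>m. kk l = enat m \<longrightarrow>
           doerfler_marking \<theta> (\<T> l) (\<lambda>\<U>. eta A f ff (\<T> l) \<U> (u l m)) (\<M> l) \<and>
           is_refine (\<T> l) (\<M> l) (\<T> (Suc l)) \<and>
           u (Suc l) 0 = u l m))"

definition index_set :: "(nat \<Rightarrow> enat) \<Rightarrow> (nat \<times> nat) set" where
  "index_set kk = {(l, k). level_reached kk l \<and> enat k \<le> kk l}"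

definition step_count :: "(nat \<Rightarrow> enat) \<Rightarrow> nat \<Rightarrow> nat \<Rightarrow> nat" where
  "step_count kk l k = card {(l', k') \<in> index_set kk. l' < l \<or> l' = l \<and> k' \<le> k}"

definition quasi_error ::
    "(real^'n::finite) set \<Rightarrow> (real^'n \<Rightarrow> real^'n^'n) \<Rightarrow> (real^'n \<Rightarrow> real) \<Rightarrow> (real^'n \<Rightarrow> real^'n) \<Rightarrow>
     ('n tagged_simplex set \<Rightarrow> real^'n \<Rightarrow> real) \<Rightarrow> (nat \<Rightarrow> 'n tagged_simplex set) \<Rightarrow>
     (nat \<Rightarrow> nat \<Rightarrow> real^'n \<Rightarrow> real) \<Rightarrow> nat \<Rightarrow> nat \<Rightarrow> real" where
  "quasi_error \<Omega> A f ff uH \<T> u l k =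
     energy_norm \<Omega> A (uH (\<T> l) - u l k) + eta A f ff (\<T> l) (\<T> l) (u l k)"

text \<open>The filter expressing \<open>|l, k| \<rightarrow> \<infinity>\<close> along the index set.\<close>

definition steps_at_top :: "(nat \<Rightarrow> enat) \<Rightarrow> (nat \<times> nat) filter" where
  "steps_at_top kk =
     inf (filtercomap (\<lambda>(l, k). step_count kk l k) at_top) (principal (index_set kk))"

end

theory Submission
  imports Defs
begin

text \<open>
  Why the quasi-error \<open>H l k = \<parallel>u\<^sub>l\<^sup>\<star> - u l k\<parallel> + \<eta>\<^sub>l(u l k)\<close> decays linearly for every \<open>\<theta>\<close> and \<open>\<lambda>\<close>.

  On one level the algebraic error contracts. As long as the solver does not stop, the estimator is
  at most \<open>1/\<lambda>\<close> times the last increment, hence it is controlled by the algebraic error and the whole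
  quasi-error decays geometrically in \<open>k\<close>; stability covers the final step
  (\<open>decay_on_level\<close>). Passing to the next level costs only a constant factor (\<open>next_level\<close>).
  This constant may exceed one and the number of solver steps per level has no upper bound, so the
  decay over many levels needs a second mechanism that gains on every level.

  That mechanism works on the final iterates. Doerfler marking with stability and reduction shrinks
  the estimator up to the change of the iterate, and the at least one solver step shrinks the
  algebraic error up to the change \<open>d l = \<parallel>u\<^bsub>l+1\<^esub>\<^sup>\<star> - u\<^sub>l\<^sup>\<star>\<parallel>\<close> of the exact discrete solutions. If the
  estimator is weighted by a small factor, the sum is contracted up to \<open>d l\<close> (\<open>weighted_step\<close>),
  whatever \<open>\<theta>\<close> and \<open>\<lambda>\<close> are. The perturbation is absorbed by Galerkin orthogonality,
  \<open>(d l)\<^sup>2 = (z l)\<^sup>2 - (z (l+1))\<^sup>2\<close> with \<open>z l = \<parallel>u\<^sup>\<star> - u\<^sub>l\<^sup>\<star>\<parallel>\<close>: adding a multiple of \<open>(z l)\<^sup>2\<close> to the square of the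
  weighted sum turns the perturbation into a telescoping term, and since reliability bounds
  \<open>z l\<close> by the quasi-error the resulting functional is contracted strictly
  (\<open>lyapunov_contracts\<close>).

  A level with \<open>m\<close> solver steps therefore multiplies the functional by at most \<open>min \<kappa> (D q\<^sup>m)\<close>. The first
  bound wins on short levels, the second one on long levels, and together they are at most
  \<open>\<sigma>\<^bsup>m+1\<^esup>\<close> for some \<open>\<sigma> < 1\<close> (\<open>min_const_geometric_le_geometric\<close>). This is a factor \<open>\<sigma>\<close> for each index
  of the level, which is linear convergence in the step count.

  All this uses the energy form only as a symmetric positive semidefinite form on \<open>H\<^sup>1\<close>. It is
  bilinear there because weak gradients are unique almost everywhere, which is the fundamental lemma
  of the calculus of variations (\<open>fundamental_lemma\<close>), and it is semidefinite because the smallest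
  value of the Rayleigh quotient of a symmetric matrix is an eigenvalue.
\<close>

section \<open>Smooth bump functions\<close>

text \<open>The one-dimensional counterpart of \<^const>\<open>cont_diff\<close>, asking for the existence of the
  derivatives instead of naming them.\<close>

primrec times_differentiable :: "nat \<Rightarrow> (real \<Rightarrow> real) \<Rightarrow> bool" where
  "times_differentiable 0 h \<longleftrightarrow> continuous_on UNIV h"
| "times_differentiable (Suc k) h \<longleftrightarrow> (\<exists>h'. (\<forall>t. (h has_real_derivative h' t) (at t)) \<and> times_differentiable k h')"

lemma times_differentiable_SucI:
  "(\<And>t. (h has_real_derivative h' t) (at t)) \<Longrightarrow> times_differentiable k h' \<Longrightarrow> times_differentiable (Suc k) h"
  by auto

lemma times_differentiable_SucE:
  assumes "times_differentiable (Suc k) h"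
  obtains h' where "\<And>t. (h has_real_derivative h' t) (at t)" "times_differentiable k h'"
  using assms by auto

lemma times_differentiable_Suc_imp: "times_differentiable (Suc k) h \<Longrightarrow> times_differentiable k h"
proof (induction k arbitrary: h)
  case 0
  then show ?case
    by (auto intro: DERIV_continuous_on)
next
  case (Suc k)
  then show ?case by (metis times_differentiable.simps(2))
qed

lemma times_differentiable_add: "times_differentiable k g \<Longrightarrow> times_differentiable k h \<Longrightarrow> times_differentiable k (\<lambda>t. g t + h t)"
proof (induction k arbitrary: g h)
  case 0
  then show ?case by (auto intro: continuous_on_add)
next
  case (Suc k)
  then obtain g' h' where "\<And>t. (g has_real_derivative g' t) (at t)" "times_differentiable k g'"
    "\<And>t. (h has_real_derivative h' t) (at t)" "times_differentiable k h'" by (metis times_differentiable_SucE)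
  then show ?case
    by (intro times_differentiable_SucI[of _ "\<lambda>t. g' t + h' t"] DERIV_add Suc.IH)
qed

lemma times_differentiable_mult: "times_differentiable k g \<Longrightarrow> times_differentiable k h \<Longrightarrow> times_differentiable k (\<lambda>t. g t * h t)"
proof (induction k arbitrary: g h)
  case 0
  then show ?case by (auto intro: continuous_on_mult)
next
  case (Suc k)
  then obtain g' h' where *: "\<And>t. (g has_real_derivative g' t) (at t)" "times_differentiable k g'"
    "\<And>t. (h has_real_derivative h' t) (at t)" "times_differentiable k h'" by (metis times_differentiable_SucE)
  have gh: "times_differentiable k g" "times_differentiable k h"
    using Suc.prems by (simp_all only: times_differentiable_Suc_imp)
  have "times_differentiable k (\<lambda>t. g' t * h t + h' t * g t)"
    by (rule times_differentiable_add[OF Suc.IH[OF *(2) gh(2)] Suc.IH[OF *(4) gh(1)]])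
  with DERIV_mult[OF *(1) *(3)] show ?case by (rule times_differentiable_SucI)
qed

lemma times_differentiable_const: "times_differentiable k (\<lambda>t. c)"
proof (induction k arbitrary: c)
  case (Suc k)
  show ?case by (rule times_differentiable_SucI[OF DERIV_const Suc])
qed simp

lemma times_differentiable_affine: "times_differentiable k h \<Longrightarrow> times_differentiable k (\<lambda>t. h (c * t + d))"
proof (induction k arbitrary: h)
  case 0
  then show ?case
    by (simp add: continuous_on_compose2[of UNIV h UNIV "\<lambda>t. c * t + d"] continuous_intros)
next
  case (Suc k)
  then obtain h' where *: "\<And>t. (h has_real_derivative h' t) (at t)" "times_differentiable k h'" by auto
  have "((\<lambda>t. h (c * t + d)) has_real_derivative c * h' (c * t + d)) (at t)" for t
    by (rule DERIV_cong[OF DERIV_chain2[OF *(1)]]) (auto intro!: derivative_eq_intros)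
  moreover have "times_differentiable k (\<lambda>t. c * h' (c * t + d))"
    by (intro times_differentiable_mult times_differentiable_const Suc.IH *)
  ultimately show ?case by (rule times_differentiable_SucI)
qed

text \<open>For \<open>n = 0\<close> this is the classical smooth function that vanishes on the negative half-line. The
  powers of \<open>1/t\<close> make the family closed under differentiation up to linear combinations
  (\<open>flat_has_derivative\<close>), so smoothness follows by one induction for all \<open>n\<close> at once.\<close>

definition flat :: "nat \<Rightarrow> real \<Rightarrow> real" where
  "flat n t = (if 0 < t then inverse t ^ n * exp (- inverse t) else 0)"

lemma flat_tendsto_0: "(flat n \<longlongrightarrow> 0) (at 0)"
proof -
  have "((\<lambda>t. inverse t ^ n / exp (inverse t)) \<longlongrightarrow> (0::real)) (at_right 0)"
    by (rule filterlim_compose[OF tendsto_power_div_exp_0 filterlim_inverse_at_top_right])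
  then have "(flat n \<longlongrightarrow> 0) (at_right 0)"
    by (rule Lim_transform_eventually)
      (auto simp: flat_def eventually_at_right_less exp_minus divide_inverse intro!: eventually_at_rightI[of 0 1])
  moreover have "(flat n \<longlongrightarrow> 0) (at_left 0)"
    by (rule Lim_transform_eventually[OF tendsto_const])
      (auto simp: flat_def intro!: eventually_at_leftI[of "-1" 0])
  ultimately show ?thesis by (simp add: filterlim_split_at)
qed

lemma flat_has_derivative:
  "(flat n has_real_derivative flat (n + 2) t - real n * flat (n + 1) t) (at t)"
proof -
  consider "t < 0" | "t = 0" | "0 < t" by linarith
  then show ?thesis
  proof cases
    case 1
    have "((\<lambda>_. 0::real) has_real_derivative 0) (at t)" by simp
    then have "(flat n has_real_derivative 0) (at t)"
      by (rule has_field_derivative_transform_within_open[of _ _ _ "{..<0}"])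
        (use 1 in \<open>auto simp: flat_def\<close>)
    then show ?thesis using 1 by (simp add: flat_def)
  next
    case 2
    have "((\<lambda>h. (flat n (0 + h) - flat n 0) / h) \<longlongrightarrow> 0) (at 0)"
      by (rule Lim_transform_eventually[OF flat_tendsto_0[of "Suc n"]])
        (auto simp: flat_def eventually_at_filter divide_inverse)
    then have "(flat n has_real_derivative 0) (at 0)" by (simp add: DERIV_def)
    then show ?thesis using 2 by (simp add: flat_def)
  next
    case 3
    have "((\<lambda>t. inverse t ^ n * exp (- inverse t)) has_real_derivative
        inverse t ^ (n + 2) * exp (- inverse t) - real n * (inverse t ^ (n + 1) * exp (- inverse t))) (at t)"
    proof -
      have inv: "(inverse has_real_derivative - (inverse t ^ 2)) (at t)"
        using DERIV_inverse[of t UNIV] 3 by (simp add: numeral_2_eq_2)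
      have "((\<lambda>t. inverse t ^ n) has_real_derivative - real n * inverse t ^ (n + 1)) (at t)"
        by (rule DERIV_cong[OF DERIV_power[OF inv]])
          (cases n; simp add: power2_eq_square algebra_simps)
      moreover have "((\<lambda>t. exp (- inverse t)) has_real_derivative inverse t ^ 2 * exp (- inverse t)) (at t)"
        by (rule DERIV_cong[OF DERIV_chain2[OF DERIV_exp DERIV_minus[OF inv]]]) simp
      ultimately show ?thesis
        by (rule DERIV_cong[OF DERIV_mult]) (simp add: power_add power2_eq_square algebra_simps)
    qed
    then have "(flat n has_real_derivative
        inverse t ^ (n + 2) * exp (- inverse t) - real n * (inverse t ^ (n + 1) * exp (- inverse t))) (at t)"
      by (rule has_field_derivative_transform_within_open[of _ _ _ "{0<..}"])
        (use 3 in \<open>auto simp: flat_def\<close>)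
    then show ?thesis using 3 by (simp add: flat_def)
  qed
qed

lemma times_differentiable_flat: "times_differentiable k (flat n)"
proof (induction k arbitrary: n)
  case 0
  show ?case
    using DERIV_continuous_on[OF flat_has_derivative] by simp
next
  case (Suc k)
  have "times_differentiable k (\<lambda>t. flat (n + 2) t + (- real n) * flat (n + 1) t)"
    by (intro times_differentiable_add times_differentiable_mult times_differentiable_const Suc)
  then have "times_differentiable k (\<lambda>t. flat (n + 2) t - real n * flat (n + 1) t)" by simp
  with flat_has_derivative[of n] show ?case by (rule times_differentiable_SucI)
qed

lemma tensor_product_has_derivative:
  fixes h h' :: "'n::finite \<Rightarrow> real \<Rightarrow> real"
  assumes "\<And>i t. (h i has_real_derivative h' i t) (at t)"
  shows "((\<lambda>x::real^'n. \<Prod>i\<in>UNIV. h i (x $ i)) has_derivative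
     (\<lambda>y. \<Sum>i\<in>UNIV. (h' i (x $ i) * y $ i) * (\<Prod>j\<in>UNIV - {i}. h j (x $ j)))) (at x)"
proof -
  have "((\<lambda>x::real^'n. h i (x $ i)) has_derivative (\<lambda>y. h' i (x $ i) * y $ i)) (at x)" for i
    by (rule has_derivative_compose[where f = "\<lambda>x. x $ i" and f' = "\<lambda>y. y $ i",
          OF bounded_linear_imp_has_derivative[OF bounded_linear_vec_nth]
             assms[of i "x $ i", unfolded has_field_derivative_def]])
  from has_derivative_prod[of UNIV "\<lambda>i x. h i (x $ i)" "\<lambda>i y. h' i (x $ i) * y $ i" x UNIV, OF this]
  show ?thesis by simp
qed

text \<open>A partial derivative of a tensor product is the tensor product with one factor differentiated,
  so the induction stays within tensor products.\<close>

lemma cont_diff_tensor_product: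
  fixes h :: "'n::finite \<Rightarrow> real \<Rightarrow> real"
  assumes "\<And>i. times_differentiable k (h i)"
  shows "cont_diff k (\<lambda>x::real^'n. \<Prod>i\<in>UNIV. h i (x $ i))"
  using assms
proof (induction k arbitrary: h)
  case 0
  then show ?case
    by (auto intro!: continuous_on_prod continuous_on_compose2[of UNIV "h i" UNIV "\<lambda>x. x $ i" for i]
        intro: linear_continuous_on bounded_linear_vec_nth)
next
  case (Suc k)
  obtain h' where h': "\<And>i t. (h i has_real_derivative h' i t) (at t)" "\<And>i. times_differentiable k (h' i)"
    using Suc.prems unfolding times_differentiable.simps by metis
  let ?f = "\<lambda>x::real^'n. \<Prod>i\<in>UNIV. h i (x $ i)"
  note D = tensor_product_has_derivative[of h h', OF h'(1)]
  have "partial_deriv i ?f = (\<lambda>x. \<Prod>j\<in>UNIV. (h(i := h' i)) j (x $ j))" for i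
  proof
    fix x :: "real^'n"
    have "partial_deriv i ?f x
      = (\<Sum>l\<in>UNIV. (h' l (x $ l) * axis i 1 $ l) * (\<Prod>j\<in>UNIV - {l}. h j (x $ j)))"
      by (simp add: partial_deriv_def frechet_derivative_at[OF D, symmetric])
    also have "\<dots> = (\<Sum>l\<in>UNIV. if i = l then h' l (x $ l) * (\<Prod>j\<in>UNIV - {l}. h j (x $ j)) else 0)"
      by (intro sum.cong) (auto simp: axis_def)
    also have "\<dots> = h' i (x $ i) * (\<Prod>j\<in>UNIV - {i}. h j (x $ j))" by simp
    also have "(\<Prod>j\<in>UNIV - {i}. h j (x $ j)) = (\<Prod>j\<in>UNIV - {i}. (h(i := h' i)) j (x $ j))"
      by (intro prod.cong) auto
    also have "h' i (x $ i) * \<dots> = (\<Prod>j\<in>UNIV. (h(i := h' i)) j (x $ j))"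
      by (subst prod.remove[of UNIV i]) auto
    finally show "partial_deriv i ?f x = (\<Prod>j\<in>UNIV. (h(i := h' i)) j (x $ j))" .
  qed
  moreover have "cont_diff k (\<lambda>x. \<Prod>j\<in>UNIV. (h(i := h' i)) j (x $ j))" for i
    by (rule Suc.IH) (metis Suc.prems h'(2) times_differentiable_Suc_imp fun_upd_apply)
  moreover have "?f differentiable_on UNIV"
    using D unfolding differentiable_on_def differentiable_def by blast
  ultimately show ?case by simp
qed

text \<open>As \<open>m\<close> grows these functions increase to the indicator function of the box.\<close>

definition box_bump :: "real^'n::finite \<Rightarrow> real^'n \<Rightarrow> nat \<Rightarrow> real^'n \<Rightarrow> real" where
  "box_bump a b m x = (\<Prod>i\<in>UNIV. flat 0 (real m * (x $ i - a $ i)) * flat 0 (real m * (b $ i - x $ i)))"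

lemma flat_0_bounds: "0 \<le> flat 0 t" "flat 0 t \<le> 1"
  by (auto simp: flat_def)

lemma box_bump_bounds: "0 \<le> box_bump a b m x" "box_bump a b m x \<le> 1"
  unfolding box_bump_def
  by (intro prod_nonneg prod_le_1 conjI mult_nonneg_nonneg mult_le_one flat_0_bounds ballI)+

lemma box_bump_eq_0: "x \<notin> box a b \<Longrightarrow> box_bump a b m x = 0"
proof -
  assume "x \<notin> box a b"
  then obtain i where "\<not> (a $ i < x $ i \<and> x $ i < b $ i)" by (auto simp: mem_box_cart)
  then have "flat 0 (real m * (x $ i - a $ i)) * flat 0 (real m * (b $ i - x $ i)) = 0"
    by (auto simp: flat_def zero_less_mult_iff)
  then show ?thesis unfolding box_bump_def by (intro prod_zero) auto
qed

lemma box_bump_tendsto: "(\<lambda>m. box_bump a b m x) \<longlonglongrightarrow> indicator (box a b) x"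
proof (cases "x \<in> box a b")
  case True
  have lim: "(\<lambda>m. flat 0 (real m * s)) \<longlonglongrightarrow> 1" if "0 < s" for s
  proof -
    have "(\<lambda>m. exp (- (inverse (real m) * inverse s))) \<longlonglongrightarrow> exp (- (0 * inverse s))"
      by (intro tendsto_intros lim_inverse_n)
    then have "(\<lambda>m. exp (- (inverse (real m) * inverse s))) \<longlonglongrightarrow> 1" by simp
    then show ?thesis
      by (rule Lim_transform_eventually)
        (use that in \<open>auto simp: flat_def intro!: eventually_sequentiallyI[of 1]\<close>)
  qed
  have "(\<lambda>m. box_bump a b m x) \<longlonglongrightarrow> (\<Prod>i::'a\<in>UNIV. 1 * 1)"
    unfolding box_bump_def
    by (intro tendsto_prod tendsto_mult lim) (use True in \<open>auto simp: mem_box_cart\<close>)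
  then show ?thesis using True by simp
next
  case False
  then show ?thesis by (simp add: box_bump_eq_0)
qed

lemma box_bump_test_function:
  assumes "cbox a b \<subseteq> \<Omega>"
  shows "box_bump a b m \<in> test_functions \<Omega>"
proof -
  have "times_differentiable k (\<lambda>t. flat 0 (real m * (t - a $ i)) * flat 0 (real m * (b $ i - t)))" for k i
  proof -
    have "times_differentiable k (\<lambda>t. flat 0 (real m * t + (- real m * a $ i)) * flat 0 ((- real m) * t + real m * b $ i))"
      by (intro times_differentiable_mult times_differentiable_affine times_differentiable_flat)
    then show ?thesis by (simp add: algebra_simps)
  qed
  from cont_diff_tensor_product[OF this]
  have "cont_diff k (box_bump a b m)" for k
    by (simp add: box_bump_def[abs_def])
  moreover have sub: "closure {x. box_bump a b m x \<noteq> 0} \<subseteq> cbox a b"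
  proof (rule closure_minimal)
    show "{x. box_bump a b m x \<noteq> 0} \<subseteq> cbox a b"
      using box_bump_eq_0[of _ a b m] box_subset_cbox[of a b] by blast
  qed (rule closed_cbox)
  moreover have "compact (closure {x. box_bump a b m x \<noteq> 0})"
    using bounded_subset[OF bounded_cbox sub] by (simp add: compact_eq_bounded_closed)
  ultimately show ?thesis
    using assms by (simp add: test_functions_def)
qed

section \<open>Weak gradients\<close>

text \<open>The bump functions converge boundedly to the indicator function of a box, so \<open>G\<close> has integral zero
  over every closed box in \<open>\<Omega>\<close>. By Lebesgue differentiation almost every value of \<open>G\<close> is a limit of averages
  over small boxes.\<close>

lemma fundamental_lemma:
  fixes G :: "real^'n::finite \<Rightarrow> 'b::euclidean_space"
  assumes "open \<Omega>" and G: "integrable (lebesgue_on \<Omega>) G"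
    and test: "\<And>\<phi>. \<phi> \<in> test_functions \<Omega> \<Longrightarrow> (LINT x|lebesgue_on \<Omega>. \<phi> x *\<^sub>R G x) = 0"
  shows "AE x in lebesgue_on \<Omega>. G x = 0"
proof -
  have meas: "\<Omega> \<in> sets lebesgue" using assms(1) by auto
  let ?g = "\<lambda>x. if x \<in> \<Omega> then G x else 0"
  have g: "integrable lebesgue ?g"
    using integrable_restrict_space[of \<Omega> lebesgue G] G meas by (simp add: indicator_scaleR_eq_if)
  have zero: "integral (cbox a b) ?g = 0" if sub: "cbox a b \<subseteq> \<Omega>" for a b
  proof -
    have "(\<lambda>m. LINT x|lebesgue_on \<Omega>. box_bump a b m x *\<^sub>R G x)
        \<longlonglongrightarrow> (LINT x|lebesgue_on \<Omega>. indicator (box a b) x *\<^sub>R G x)"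
    proof (rule integral_dominated_convergence[where w = "\<lambda>x. norm (G x)"])
      have "continuous_on UNIV (box_bump a b m)" for m
      proof -
        have "cont_diff 0 (box_bump a b m)"
          using box_bump_test_function[OF sub] unfolding test_functions_def by blast
        then show ?thesis by simp
      qed
      then have "box_bump a b m \<in> borel_measurable lebesgue" for m
        by (simp add: borel_measurable_continuous_onI measurable_completion)
      then have "box_bump a b m \<in> borel_measurable (lebesgue_on \<Omega>)" for m
        by (rule measurable_restrict_space1)
      then show "(\<lambda>x. box_bump a b m x *\<^sub>R G x) \<in> borel_measurable (lebesgue_on \<Omega>)" for m
        using G by (intro borel_measurable_scaleR) auto
      have "box a b \<in> sets lebesgue" by simp
      then have "indicator (box a b) \<in> borel_measurable (lebesgue_on \<Omega>)"
        by (intro measurable_restrict_space1 borel_measurable_indicator)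
      then show "(\<lambda>x. indicator (box a b) x *\<^sub>R G x) \<in> borel_measurable (lebesgue_on \<Omega>)"
        using G by (intro borel_measurable_scaleR) auto
      show "integrable (lebesgue_on \<Omega>) (\<lambda>x. norm (G x))" using G by simp
      show "AE x in lebesgue_on \<Omega>. (\<lambda>m. box_bump a b m x *\<^sub>R G x) \<longlonglongrightarrow> indicator (box a b) x *\<^sub>R G x"
        by (intro AE_I2 tendsto_scaleR box_bump_tendsto tendsto_const)
      show "AE x in lebesgue_on \<Omega>. norm (box_bump a b m x *\<^sub>R G x) \<le> norm (G x)" for m
        using box_bump_bounds[of a b m] by (intro AE_I2) (auto intro!: mult_left_le_one_le)
    qed
    then have "(LINT x|lebesgue_on \<Omega>. indicator (box a b) x *\<^sub>R G x) = 0"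
      unfolding test[OF box_bump_test_function[OF sub]] LIMSEQ_const_iff by (rule sym)
    also have "(LINT x|lebesgue_on \<Omega>. indicator (box a b) x *\<^sub>R G x)
        = (LINT x|lebesgue. indicator \<Omega> x *\<^sub>R indicator (box a b) x *\<^sub>R G x)"
      using meas by (simp add: integral_restrict_space)
    also have "\<dots> = (LINT x|lebesgue. indicator (box a b) x *\<^sub>R ?g x)"
      by (intro Bochner_Integration.integral_cong) (auto simp: indicator_def)
    also have "\<dots> = (LINT x|lebesgue_on (box a b). ?g x)"
      by (simp add: integral_restrict_space)
    also have "\<dots> = integral (box a b) ?g"
      using g by (intro lebesgue_integral_eq_integral)
        (auto intro!: integrable_mult_indicator simp: integrable_restrict_space)
    finally show ?thesis by (simp add: integral_open_interval)
  qed
  have local_int: "?g integrable_on cbox a b" for a b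
    by (rule integrable_on_subcbox[OF integrable_on_lebesgue[OF g]]) simp
  obtain N where N: "negligible N"
    and lim: "\<And>x \<epsilon>. x \<notin> N \<Longrightarrow> 0 < \<epsilon> \<Longrightarrow> \<exists>d>0. \<forall>h. 0 < h \<and> h < d \<longrightarrow>
       norm (integral (cbox x (x + h *\<^sub>R One)) ?g /\<^sub>R h ^ DIM(real^'n) - ?g x) < \<epsilon>"
    by (rule integrable_ccontinuous_explicit[OF local_int]) blast
  have G0: "G x = 0" if x: "x \<in> \<Omega>" "x \<notin> N" for x
  proof (rule ccontr)
    assume nz: "G x \<noteq> 0"
    then obtain d where d: "0 < d" "\<And>h. 0 < h \<Longrightarrow> h < d \<Longrightarrow>
       norm (integral (cbox x (x + h *\<^sub>R One)) ?g /\<^sub>R h ^ DIM(real^'n) - ?g x) < norm (G x)"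
      using lim[OF x(2), of "norm (G x)"] by auto
    obtain r where r: "0 < r" "cball x r \<subseteq> \<Omega>"
      using assms(1) x(1) open_contains_cball by blast
    have One: "0 < norm (One :: real^'n)" by simp
    \<comment> \<open>Small enough for the averages to be close to the value at \<open>x\<close> and for the box to stay inside \<open>\<Omega>\<close>.\<close>
    define h where "h = min (d / 2) (r / norm (One :: real^'n))"
    have h: "0 < h" "h < d" "h * norm (One :: real^'n) \<le> r"
      using d(1) r(1) One by (auto simp: h_def min_def field_simps)
    have "cbox x (x + h *\<^sub>R One) \<subseteq> cball x r"
    proof
      fix y assume y: "y \<in> cbox x (x + h *\<^sub>R One)"
      have "norm (y - x) \<le> norm (h *\<^sub>R One :: real^'n)"
        using y h(1) by (intro norm_le_componentwise) (auto simp: mem_box inner_simps)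
      then show "y \<in> cball x r" using h by (simp add: dist_norm norm_minus_commute)
    qed
    then have "integral (cbox x (x + h *\<^sub>R One)) ?g = 0" using zero r by blast
    then show False using d(2)[OF h(1,2)] x(1) by simp
  qed
  have "AE x in lebesgue_on \<Omega>. x \<notin> N"
    using AE_not_in[of N lebesgue] N meas
    by (simp add: AE_restrict_space_iff negligible_iff_null_sets eventually_mono)
  with AE_space[of "lebesgue_on \<Omega>"] show ?thesis
    by eventually_elim (use G0 in auto)
qed

text \<open>Serves both for products of functions and for the integrand of the energy form.\<close>

lemma integrable_product_bound:
  fixes f :: "real^'n \<Rightarrow> 'b::real_normed_vector" and g :: "real^'n \<Rightarrow> 'c::real_normed_vector"
    and h :: "real^'n \<Rightarrow> 'd::{banach, second_countable_topology}"
  assumes "f \<in> L2 \<Omega>" "g \<in> L2 \<Omega>" "h \<in> borel_measurable (lebesgue_on \<Omega>)"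
    and bound: "AE x in lebesgue_on \<Omega>. norm (h x) \<le> C * (norm (f x) * norm (g x))"
  shows "integrable (lebesgue_on \<Omega>) h"
proof (rule Bochner_Integration.integrable_bound)
  show "integrable (lebesgue_on \<Omega>) (\<lambda>x. \<bar>C\<bar> * ((norm (f x))\<^sup>2 + (norm (g x))\<^sup>2))"
    using assms(1,2) by (auto simp: L2_def)
  show "AE x in lebesgue_on \<Omega>. norm (h x) \<le> norm (\<bar>C\<bar> * ((norm (f x))\<^sup>2 + (norm (g x))\<^sup>2))"
    using bound
  proof eventually_elim
    case (elim x)
    have "2 * (norm (f x) * norm (g x)) \<le> (norm (f x))\<^sup>2 + (norm (g x))\<^sup>2"
      using sum_squares_bound[of "norm (f x)" "norm (g x)"] by simp
    then have p: "norm (f x) * norm (g x) \<le> (norm (f x))\<^sup>2 + (norm (g x))\<^sup>2"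
      using mult_nonneg_nonneg[OF norm_ge_zero[of "f x"] norm_ge_zero[of "g x"]] by linarith
    have "C * (norm (f x) * norm (g x)) \<le> \<bar>C\<bar> * (norm (f x) * norm (g x))"
      by (intro mult_right_mono) auto
    also have "\<dots> \<le> \<bar>C\<bar> * ((norm (f x))\<^sup>2 + (norm (g x))\<^sup>2)"
      by (rule mult_left_mono[OF p]) simp
    finally show ?case using elim by simp
  qed
qed fact

lemma L2_lincomb:
  fixes f g :: "real^'n \<Rightarrow> 'b::{banach, second_countable_topology}"
  assumes "f \<in> L2 \<Omega>" "g \<in> L2 \<Omega>"
  shows "(\<lambda>x. f x + c *\<^sub>R g x) \<in> L2 \<Omega>"
proof -
  have m: "(\<lambda>x. f x + c *\<^sub>R g x) \<in> borel_measurable (lebesgue_on \<Omega>)"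
    using assms by (auto simp: L2_def)
  have "integrable (lebesgue_on \<Omega>) (\<lambda>x. (norm (f x + c *\<^sub>R g x))\<^sup>2)"
  proof (rule Bochner_Integration.integrable_bound)
    show "integrable (lebesgue_on \<Omega>) (\<lambda>x. 2 * (norm (f x))\<^sup>2 + 2 * c\<^sup>2 * (norm (g x))\<^sup>2)"
      using assms by (auto simp: L2_def)
    have "(norm (f x + c *\<^sub>R g x))\<^sup>2 \<le> 2 * (norm (f x))\<^sup>2 + 2 * c\<^sup>2 * (norm (g x))\<^sup>2" for x
    proof -
      have "(norm (f x + c *\<^sub>R g x))\<^sup>2 \<le> (norm (f x) + \<bar>c\<bar> * norm (g x))\<^sup>2"
        by (intro power_mono order_trans[OF norm_triangle_ineq]) auto
      also have "\<dots> \<le> 2 * (norm (f x))\<^sup>2 + 2 * (\<bar>c\<bar> * norm (g x))\<^sup>2"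
        using sum_squares_bound[of "norm (f x)" "\<bar>c\<bar> * norm (g x)"] by (simp add: power2_sum)
      finally show ?thesis by (simp add: power_mult_distrib)
    qed
    then show "AE x in lebesgue_on \<Omega>. norm ((norm (f x + c *\<^sub>R g x))\<^sup>2)
        \<le> norm (2 * (norm (f x))\<^sup>2 + 2 * c\<^sup>2 * (norm (g x))\<^sup>2)"
      by (intro AE_I2) simp
  qed (use m in measurable)
  with m show ?thesis by (simp add: L2_def)
qed

lemma continuous_in_L2:
  fixes g :: "real^'n \<Rightarrow> 'b::{banach, second_countable_topology}"
  assumes g: "continuous_on UNIV g" and \<Omega>: "open \<Omega>" "bounded \<Omega>"
  shows "g \<in> L2 \<Omega>"
proof -
  interpret finite_measure "lebesgue_on \<Omega>"
    using \<Omega> by (intro finite_measure_lebesgue_on lmeasurable_open)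
  have "g \<in> borel_measurable lebesgue"
    using g by (simp add: borel_measurable_continuous_onI measurable_completion)
  then have m: "g \<in> borel_measurable (lebesgue_on \<Omega>)"
    by (rule measurable_restrict_space1)
  have "compact (g ` closure \<Omega>)"
    using \<Omega> g by (intro compact_continuous_image) (auto elim: continuous_on_subset simp: compact_closure)
  then obtain B where B: "\<forall>x\<in>closure \<Omega>. norm (g x) \<le> B"
    by (auto dest!: compact_imp_bounded simp: bounded_iff)
  have "integrable (lebesgue_on \<Omega>) (\<lambda>x. (norm (g x))\<^sup>2)"
  proof (rule integrable_const_bound)
    show "AE x in lebesgue_on \<Omega>. norm ((norm (g x))\<^sup>2) \<le> B\<^sup>2"
      using B closure_subset[of \<Omega>] by (intro AE_I2) (auto simp: subset_iff intro!: power_mono)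
  qed (use m in measurable)
  with m show ?thesis by (simp add: L2_def)
qed

lemma test_function_L2:
  assumes "\<phi> \<in> test_functions \<Omega>" "open \<Omega>" "bounded \<Omega>"
  shows "\<phi> \<in> L2 \<Omega>" "gradient \<phi> \<in> L2 \<Omega>"
proof -
  have d: "cont_diff k \<phi>" for k using assms(1) by (simp add: test_functions_def)
  show "\<phi> \<in> L2 \<Omega>" using d[of 0] by (intro continuous_in_L2 assms) simp
  have "continuous_on UNIV (\<lambda>x. \<chi> i. partial_deriv i \<phi> x)"
    using d[of "Suc 0"] by (intro continuous_on_vec_lambda) simp
  then show "gradient \<phi> \<in> L2 \<Omega>"
    by (intro continuous_in_L2 assms) (simp add: gradient_def[abs_def])
qed

context
  fixes \<Omega> :: "(real^'n::finite) set"
  assumes \<Omega>: "open \<Omega>" "bounded \<Omega>"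
begin

lemma integrable_scaleR_L2:
  fixes f :: "real^'n \<Rightarrow> real" and g :: "real^'n \<Rightarrow> 'b::{banach, second_countable_topology}"
  assumes "f \<in> L2 \<Omega>" "g \<in> L2 \<Omega>"
  shows "integrable (lebesgue_on \<Omega>) (\<lambda>x. f x *\<^sub>R g x)"
proof (rule integrable_product_bound[OF assms, where C = 1])
  show "(\<lambda>x. f x *\<^sub>R g x) \<in> borel_measurable (lebesgue_on \<Omega>)"
    using assms by (auto simp: L2_def)
qed simp

lemma weak_gradient_lincomb:
  assumes "v \<in> L2 \<Omega>" "w \<in> L2 \<Omega>" "g \<in> L2 \<Omega>" "h \<in> L2 \<Omega>"
    and "is_weak_gradient \<Omega> v g" "is_weak_gradient \<Omega> w h"
  shows "is_weak_gradient \<Omega> (\<lambda>x. v x + c * w x) (\<lambda>x. g x + c *\<^sub>R h x)"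
  unfolding is_weak_gradient_def
proof
  fix \<phi> assume \<phi>: "\<phi> \<in> test_functions \<Omega>"
  note L = test_function_L2[OF \<phi> \<Omega>]
  have "(LINT x|lebesgue_on \<Omega>. (v x + c * w x) *\<^sub>R gradient \<phi> x)
    = (LINT x|lebesgue_on \<Omega>. v x *\<^sub>R gradient \<phi> x) + c *\<^sub>R (LINT x|lebesgue_on \<Omega>. w x *\<^sub>R gradient \<phi> x)"
    using L assms by (simp add: scaleR_add_left integrable_scaleR_L2 flip: scaleR_scaleR)
  also have "\<dots> = - ((LINT x|lebesgue_on \<Omega>. \<phi> x *\<^sub>R g x) + c *\<^sub>R (LINT x|lebesgue_on \<Omega>. \<phi> x *\<^sub>R h x))"
    using assms(5,6) \<phi> by (simp add: is_weak_gradient_def)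
  also have "\<dots> = - (LINT x|lebesgue_on \<Omega>. \<phi> x *\<^sub>R g x + c *\<^sub>R (\<phi> x *\<^sub>R h x))"
    using L assms by (simp add: integrable_scaleR_L2 del: scaleR_scaleR)
  finally show "(LINT x|lebesgue_on \<Omega>. (v x + c * w x) *\<^sub>R gradient \<phi> x)
      = - (LINT x|lebesgue_on \<Omega>. \<phi> x *\<^sub>R (g x + c *\<^sub>R h x))"
    by (simp add: scaleR_add_right mult.commute)
qed

text \<open>The difference of two weak gradients is orthogonal to all test functions.\<close>

lemma weak_gradient_unique:
  assumes "g \<in> L2 \<Omega>" "h \<in> L2 \<Omega>" "is_weak_gradient \<Omega> v g" "is_weak_gradient \<Omega> v h"
  shows "AE x in lebesgue_on \<Omega>. g x = h x"
proof -
  have "continuous_on UNIV (\<lambda>x::real^'n. 1::real)" by simp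
  note one = continuous_in_L2[OF this \<Omega>]
  have "AE x in lebesgue_on \<Omega>. g x - h x = 0"
  proof (rule fundamental_lemma[OF \<Omega>(1)])
    show "integrable (lebesgue_on \<Omega>) (\<lambda>x. g x - h x)"
      using integrable_scaleR_L2[OF one assms(1)] integrable_scaleR_L2[OF one assms(2)] by simp
    fix \<phi> assume \<phi>: "\<phi> \<in> test_functions \<Omega>"
    then show "(LINT x|lebesgue_on \<Omega>. \<phi> x *\<^sub>R (g x - h x)) = 0"
      using assms test_function_L2[OF \<phi> \<Omega>]
      by (simp add: is_weak_gradient_def scaleR_diff_right integrable_scaleR_L2)
  qed
  then show ?thesis by simp
qed

lemma H1_weak_gradient:
  assumes "v \<in> H1 \<Omega>"
  shows "v \<in> L2 \<Omega>" "weak_gradient \<Omega> v \<in> L2 \<Omega>" "is_weak_gradient \<Omega> v (weak_gradient \<Omega> v)"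
  using assms someI_ex[of "\<lambda>g. g \<in> L2 \<Omega> \<and> is_weak_gradient \<Omega> v g"]
  unfolding H1_def weak_gradient_def by auto

text \<open>The chosen weak gradient depends linearly on the function, but only almost everywhere.\<close>

lemma H1_lincomb:
  assumes "v \<in> H1 \<Omega>" "w \<in> H1 \<Omega>"
  shows "(\<lambda>x. v x + c * w x) \<in> H1 \<Omega>"
    and "AE x in lebesgue_on \<Omega>. weak_gradient \<Omega> (\<lambda>x. v x + c * w x) x
       = weak_gradient \<Omega> v x + c *\<^sub>R weak_gradient \<Omega> w x"
proof -
  note v = H1_weak_gradient[OF assms(1)] and w = H1_weak_gradient[OF assms(2)]
  note g = weak_gradient_lincomb[OF v(1) w(1) v(2) w(2) v(3) w(3), of c]
  have gL: "(\<lambda>x. weak_gradient \<Omega> v x + c *\<^sub>R weak_gradient \<Omega> w x) \<in> L2 \<Omega>"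
    by (rule L2_lincomb[OF v(2) w(2)])
  have "(\<lambda>x. v x + c * w x) \<in> L2 \<Omega>"
    using L2_lincomb[OF v(1) w(1), of c] by simp
  with g gL show H: "(\<lambda>x. v x + c * w x) \<in> H1 \<Omega>" unfolding H1_def by blast
  show "AE x in lebesgue_on \<Omega>. weak_gradient \<Omega> (\<lambda>x. v x + c * w x) x
       = weak_gradient \<Omega> v x + c *\<^sub>R weak_gradient \<Omega> w x"
    by (rule weak_gradient_unique[OF H1_weak_gradient(2)[OF H] gL H1_weak_gradient(3)[OF H] g])
qed

lemma H1_diff: "v \<in> H1 \<Omega> \<Longrightarrow> w \<in> H1 \<Omega> \<Longrightarrow> v - w \<in> H1 \<Omega>"
  using H1_lincomb(1)[of v w "-1"] by (simp add: fun_diff_def)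

lemma zero_test_function: "(\<lambda>x. 0) \<in> test_functions \<Omega>"
proof -
  have partial: "partial_deriv i (\<lambda>x::real^'n. 0) = (\<lambda>x. 0)" for i
    by (simp add: partial_deriv_def[abs_def])
  have "cont_diff k (\<lambda>x::real^'n. 0)" for k
    by (induction k) (simp_all only: cont_diff.simps partial differentiable_on_const continuous_on_const simp_thms)
  then show ?thesis by (simp add: test_functions_def)
qed

text \<open>The initial guess of the algorithm. Even here uniqueness is needed, because the chosen weak gradient of the
  zero function is some null function.\<close>

lemma zero_in_H10: "(\<lambda>x. 0) \<in> H10 \<Omega>"
proof -
  have L: "(\<lambda>x. 0 :: real) \<in> L2 \<Omega>" "(\<lambda>x. 0 :: real^'n) \<in> L2 \<Omega>" by (simp_all add: L2_def)
  have g: "is_weak_gradient \<Omega> (\<lambda>x. 0) (\<lambda>x. 0)" by (simp add: is_weak_gradient_def)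
  have H: "(\<lambda>x. 0) \<in> H1 \<Omega>" unfolding H1_def by (intro CollectI conjI bexI[of _ "\<lambda>x. 0"] L g)
  have grad: "gradient (\<lambda>x::real^'n. 0) x = 0" for x
    by (simp add: gradient_def partial_deriv_def vec_eq_iff)
  have ae: "AE x in lebesgue_on \<Omega>. weak_gradient \<Omega> (\<lambda>x. 0) x = 0"
    by (rule weak_gradient_unique[OF H1_weak_gradient(2)[OF H] L(2) H1_weak_gradient(3)[OF H] g])
  then have "(LINT x|lebesgue_on \<Omega>. (norm (gradient (\<lambda>x. 0) x - weak_gradient \<Omega> (\<lambda>x. 0) x))\<^sup>2) = 0"
    by (intro integral_eq_zero_AE) (auto simp: grad)
  then have "\<exists>\<phi>. (\<forall>n::nat. \<phi> n \<in> test_functions \<Omega>) \<and>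
     (\<lambda>n. LINT x|lebesgue_on \<Omega>. (\<phi> n x - 0)\<^sup>2) \<longlonglongrightarrow> 0 \<and>
     (\<lambda>n. LINT x|lebesgue_on \<Omega>. (norm (gradient (\<phi> n) x - weak_gradient \<Omega> (\<lambda>x. 0) x))\<^sup>2) \<longlonglongrightarrow> 0"
    using zero_test_function by (intro exI[of _ "\<lambda>n x. 0"]) simp
  with H show ?thesis unfolding H10_def by (intro CollectI conjI)
qed

end

section \<open>The energy form\<close>

lemma norm_matrix_vector_le:
  fixes M :: "real^'n^'m"
  shows "norm (M *v x) \<le> norm M * norm x"
proof -
  have "norm (M *v x) \<le> L2_set (\<lambda>i. norm (M $ i) * norm x) UNIV"
    unfolding norm_vec_def[of "M *v x"]
    by (rule L2_set_mono) (simp_all add: matrix_vector_mul_component Cauchy_Schwarz_ineq2)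
  also have "\<dots> = norm M * norm x"
    by (simp add: norm_vec_def[of M] L2_set_left_distrib)
  finally show ?thesis .
qed

lemma borel_measurable_matrix_vector:
  fixes M :: "'a \<Rightarrow> real^'n^'m"
  assumes "M \<in> borel_measurable N" "g \<in> borel_measurable N"
  shows "(\<lambda>x. M x *v g x) \<in> borel_measurable N"
proof (rule borel_measurable_continuous_Pair[OF assms])
  show "continuous_on UNIV (\<lambda>x :: (real^'n^'m) \<times> (real^'n). fst x *v snd x)"
    unfolding matrix_vector_mult_def
    by (intro continuous_on_vec_lambda continuous_on_sum continuous_on_mult continuous_on_component
        continuous_on_fst continuous_on_snd continuous_on_id)
qed

text \<open>This is behind the Cauchy-Schwarz inequality of the energy form as well as the fact that a minimiser
  of the Rayleigh quotient is an eigenvector.\<close>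

lemma discriminant_nonneg_quadratic:
  fixes \<alpha> \<beta> \<gamma> :: real
  assumes "0 \<le> \<gamma>" and nonneg: "\<And>t. 0 \<le> \<alpha> + 2 * t * \<beta> + t\<^sup>2 * \<gamma>"
  shows "\<beta>\<^sup>2 \<le> \<alpha> * \<gamma>"
proof (cases "\<gamma> = 0")
  case True
  have "\<beta> = 0"
  proof (rule ccontr)
    assume "\<beta> \<noteq> 0"
    then show False using nonneg[of "- (\<alpha> + 1) / (2 * \<beta>)"] True by (simp add: field_simps)
  qed
  then show ?thesis using True by simp
next
  case False
  have "\<alpha> + 2 * (- \<beta> / \<gamma>) * \<beta> + (- \<beta> / \<gamma>)\<^sup>2 * \<gamma> = \<alpha> - \<beta>\<^sup>2 / \<gamma>"
    using False by (simp add: power2_eq_square)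
  with nonneg[of "- \<beta> / \<gamma>"] have "\<beta>\<^sup>2 / \<gamma> \<le> \<alpha>" by simp
  then show ?thesis using False assms(1) by (simp add: pos_divide_le_eq)
qed

lemma symmetric_matrix_inner:
  fixes M :: "real^'n^'n"
  assumes "transpose M = M"
  shows "(M *v x) \<bullet> y = x \<bullet> (M *v y)"
  using dot_lmul_matrix[of x "transpose M" y] by (simp add: assms flip: transpose_matrix_vector)

text \<open>Eigenvectors of different eigenvalues are orthogonal, and orthogonal nonzero vectors are finite in number. Without
  finiteness the minimum in \<^const>\<open>lambda_min\<close> would carry no information.\<close>

lemma finite_eigenvalues:
  fixes M :: "real^'n::finite^'n"
  assumes sym: "transpose M = M"
  shows "finite (eigenvalues M)"
proof -
  have "\<exists>v. \<forall>\<mu>\<in>eigenvalues M. v \<mu> \<noteq> 0 \<and> M *v v \<mu> = \<mu> *\<^sub>R v \<mu>"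
    by (rule bchoice) (auto simp: eigenvalues_def)
  then obtain v where v: "\<And>\<mu>. \<mu> \<in> eigenvalues M \<Longrightarrow> v \<mu> \<noteq> 0 \<and> M *v v \<mu> = \<mu> *\<^sub>R v \<mu>"
    by blast
  have orth: "v \<mu> \<bullet> v \<nu> = 0" if "\<mu> \<in> eigenvalues M" "\<nu> \<in> eigenvalues M" "\<mu> \<noteq> \<nu>" for \<mu> \<nu>
    using symmetric_matrix_inner[OF sym, of "v \<mu>" "v \<nu>"] v[OF that(1)] v[OF that(2)] that(3) by auto
  have "inj_on v (eigenvalues M)"
    using orth v by (metis inj_onI inner_eq_zero_iff)
  moreover have "pairwise orthogonal (v ` eigenvalues M)"
    unfolding pairwise_def orthogonal_def using orth by blast
  then have "finite (v ` eigenvalues M)" by (rule pairwise_orthogonal_imp_finite)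
  ultimately show ?thesis by (simp add: finite_image_iff)
qed

text \<open>Let \<open>\<mu>\<close> be the minimum of the Rayleigh quotient over the unit sphere, attained at \<open>v\<close>. The form
  \<open>(M y) \<bullet> y - \<mu> (y \<bullet> y)\<close> is nonnegative and vanishes at \<open>v\<close>, so \<open>v\<close> lies in its kernel. Hence \<open>\<mu>\<close> is an
  eigenvalue and bounds \<^const>\<open>lambda_min\<close> from above.\<close>

lemma lambda_min_le_rayleigh:
  fixes M :: "real^'n::finite^'n"
  assumes sym: "transpose M = M"
  shows "lambda_min M * (x \<bullet> x) \<le> (M *v x) \<bullet> x"
proof -
  let ?R = "\<lambda>y. (M *v y) \<bullet> y"
  have "axis undefined 1 \<in> sphere (0 :: real^'n) 1" by simp
  then have "sphere (0 :: real^'n) 1 \<noteq> {}" by blast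
  moreover have "continuous_on (sphere 0 1) ?R" by (intro continuous_intros)
  ultimately obtain v where v: "v \<in> sphere 0 1" "\<And>y. y \<in> sphere 0 1 \<Longrightarrow> ?R v \<le> ?R y"
    using continuous_attains_inf[OF compact_sphere, of 0 1 ?R] by blast
  define \<mu> where "\<mu> = ?R v"
  have vv: "v \<bullet> v = 1" using v(1) by (simp add: dot_square_norm)
  have ge: "\<mu> * (y \<bullet> y) \<le> ?R y" for y
  proof (cases "y = 0")
    case False
    have "\<mu> \<le> ?R ((1 / norm y) *\<^sub>R y)"
      unfolding \<mu>_def by (rule v(2)) (use False in simp)
    also have "\<dots> = ?R y / (y \<bullet> y)"
      by (simp add: matrix_vector_mult_scaleR dot_square_norm power2_eq_square)
    finally show ?thesis using False by (simp add: field_simps)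
  qed (simp)
  have \<mu>: "v \<bullet> (M *v v) = \<mu>" by (simp add: \<mu>_def inner_commute)
  have "(M *v v - \<mu> *\<^sub>R v) \<bullet> y = 0" for y
  proof -
    have "0 \<le> 0 + 2 * t * ((M *v v - \<mu> *\<^sub>R v) \<bullet> y) + t\<^sup>2 * (?R y - \<mu> * (y \<bullet> y))" for t
      using ge[of "v + t *\<^sub>R y"] symmetric_matrix_inner[OF sym, of y v] vv
      by (simp add: \<mu> matrix_vector_right_distrib matrix_vector_mult_scaleR inner_simps
          inner_commute algebra_simps power2_eq_square)
    from discriminant_nonneg_quadratic[OF _ this] ge[of y] show ?thesis by simp
  qed
  then have "M *v v = \<mu> *\<^sub>R v" by (metis eq_iff_diff_eq_0 inner_eq_zero_iff)
  moreover have "v \<noteq> 0" using vv by auto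
  ultimately have "\<mu> \<in> eigenvalues M" by (auto simp: eigenvalues_def)
  then have "lambda_min M \<le> \<mu>"
    unfolding lambda_min_def by (rule Min_le[OF finite_eigenvalues[OF sym]])
  then have "lambda_min M * (x \<bullet> x) \<le> \<mu> * (x \<bullet> x)" by (intro mult_right_mono) auto
  with ge[of x] show ?thesis by simp
qed

lemma diffusion_coefficient_nonneg:
  assumes "diffusion_coefficient \<Omega> A"
  shows "AE x in lebesgue_on \<Omega>. \<forall>y. 0 \<le> (A x *v y) \<bullet> y"
proof -
  let ?f = "\<lambda>x. ereal (lambda_min (A x))"
  have "AE x in lebesgue_on \<Omega>. - ?f x \<le> esssup (lebesgue_on \<Omega>) (\<lambda>x. - ?f x)"
    by (rule esssup_AE)
  moreover have "AE x in lebesgue_on \<Omega>. transpose (A x) = A x"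
    using assms by (simp add: diffusion_coefficient_def)
  ultimately show ?thesis
  proof eventually_elim
    case (elim x)
    have "esssup (lebesgue_on \<Omega>) (\<lambda>x. - ?f x) < 0"
      using assms by (simp add: diffusion_coefficient_def essinf_def)
    with elim(1) have "- ?f x < 0" by (rule le_less_trans)
    then have "0 \<le> lambda_min (A x)" by simp
    then have "0 \<le> lambda_min (A x) * (y \<bullet> y)" for y by simp
    then show ?case using lambda_min_le_rayleigh[OF elim(2)] order_trans by blast
  qed
qed

context
  fixes \<Omega> :: "(real^'n::finite) set" and A :: "real^'n \<Rightarrow> real^'n^'n"
  assumes \<Omega>: "open \<Omega>" "bounded \<Omega>" and A: "diffusion_coefficient \<Omega> A"
begin

lemma energy_integrable:
  assumes "g \<in> L2 \<Omega>" "h \<in> L2 \<Omega>"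
  shows "integrable (lebesgue_on \<Omega>) (\<lambda>x. (A x *v g x) \<bullet> h x)"
proof -
  obtain C where C: "AE x in lebesgue_on \<Omega>. norm (A x) \<le> C"
    using A by (auto simp: diffusion_coefficient_def)
  have "A \<in> borel_measurable (lebesgue_on \<Omega>)" "g \<in> borel_measurable (lebesgue_on \<Omega>)"
    "h \<in> borel_measurable (lebesgue_on \<Omega>)"
    using A assms by (auto simp: diffusion_coefficient_def L2_def)
  then have m: "(\<lambda>x. (A x *v g x) \<bullet> h x) \<in> borel_measurable (lebesgue_on \<Omega>)"
    by (intro borel_measurable_inner borel_measurable_matrix_vector)
  show ?thesis
  proof (rule integrable_product_bound[OF assms m])
    show "AE x in lebesgue_on \<Omega>. norm ((A x *v g x) \<bullet> h x) \<le> C * (norm (g x) * norm (h x))"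
      using C
    proof eventually_elim
      case (elim x)
      have "norm ((A x *v g x) \<bullet> h x) \<le> norm (A x *v g x) * norm (h x)"
        by (simp add: Cauchy_Schwarz_ineq2)
      also have "\<dots> \<le> (norm (A x) * norm (g x)) * norm (h x)"
        by (intro mult_right_mono norm_matrix_vector_le) simp
      also have "\<dots> \<le> (C * norm (g x)) * norm (h x)"
        by (intro mult_right_mono elim) auto
      finally show ?case by simp
    qed
  qed
qed

lemma energy_form_symmetric:
  assumes "v \<in> H1 \<Omega>" "w \<in> H1 \<Omega>"
  shows "energy_form \<Omega> A v w = energy_form \<Omega> A w v"
  unfolding energy_form_def
proof (rule integral_cong_AE)
  note int = energy_integrable[OF H1_weak_gradient(2)[OF \<Omega>] H1_weak_gradient(2)[OF \<Omega>]]
  have "AE x in lebesgue_on \<Omega>. transpose (A x) = A x"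
    using A by (simp add: diffusion_coefficient_def)
  then show "AE x in lebesgue_on \<Omega>. (A x *v weak_gradient \<Omega> v x) \<bullet> weak_gradient \<Omega> w x
      = (A x *v weak_gradient \<Omega> w x) \<bullet> weak_gradient \<Omega> v x"
    by eventually_elim (metis symmetric_matrix_inner inner_commute)
  show "(\<lambda>x. (A x *v weak_gradient \<Omega> v x) \<bullet> weak_gradient \<Omega> w x) \<in> borel_measurable (lebesgue_on \<Omega>)"
    "(\<lambda>x. (A x *v weak_gradient \<Omega> w x) \<bullet> weak_gradient \<Omega> v x) \<in> borel_measurable (lebesgue_on \<Omega>)"
    by (rule borel_measurable_integrable[OF int], (rule assms)+)+
qed

lemma energy_form_lincomb:
  assumes "v \<in> H1 \<Omega>" "w \<in> H1 \<Omega>" "y \<in> H1 \<Omega>"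
  shows "energy_form \<Omega> A (\<lambda>x. v x + c * w x) y = energy_form \<Omega> A v y + c * energy_form \<Omega> A w y"
proof -
  let ?g = "weak_gradient \<Omega>"
  note L = H1_weak_gradient(2)[OF \<Omega>] and comb = H1_lincomb[OF \<Omega> assms(1,2), of c]
  have int: "integrable (lebesgue_on \<Omega>) (\<lambda>x. (A x *v ?g a x) \<bullet> ?g b x)" if "a \<in> H1 \<Omega>" "b \<in> H1 \<Omega>" for a b
    by (rule energy_integrable[OF L[OF that(1)] L[OF that(2)]])
  have "energy_form \<Omega> A (\<lambda>x. v x + c * w x) y
      = (LINT x|lebesgue_on \<Omega>. (A x *v ?g v x) \<bullet> ?g y x + c * ((A x *v ?g w x) \<bullet> ?g y x))"
    unfolding energy_form_def
  proof (rule integral_cong_AE)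
    show "AE x in lebesgue_on \<Omega>. (A x *v ?g (\<lambda>x. v x + c * w x) x) \<bullet> ?g y x
        = (A x *v ?g v x) \<bullet> ?g y x + c * ((A x *v ?g w x) \<bullet> ?g y x)"
      using comb(2)
      by eventually_elim (simp add: matrix_vector_right_distrib matrix_vector_mult_scaleR inner_add_left)
    show "(\<lambda>x. (A x *v ?g (\<lambda>x. v x + c * w x) x) \<bullet> ?g y x) \<in> borel_measurable (lebesgue_on \<Omega>)"
      by (rule borel_measurable_integrable[OF int[OF comb(1) assms(3)]])
    show "(\<lambda>x. (A x *v ?g v x) \<bullet> ?g y x + c * ((A x *v ?g w x) \<bullet> ?g y x)) \<in> borel_measurable (lebesgue_on \<Omega>)"
      using int[OF assms(1,3)] int[OF assms(2,3)] by (intro borel_measurable_integrable) simp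
  qed
  also have "\<dots> = energy_form \<Omega> A v y + c * energy_form \<Omega> A w y"
    using int[OF assms(1,3)] int[OF assms(2,3)] by (simp add: energy_form_def)
  finally show ?thesis .
qed

lemma energy_form_diff:
  assumes "v \<in> H1 \<Omega>" "w \<in> H1 \<Omega>" "y \<in> H1 \<Omega>"
  shows "energy_form \<Omega> A (v - w) y = energy_form \<Omega> A v y - energy_form \<Omega> A w y"
  using energy_form_lincomb[OF assms, of "-1"] by (simp add: fun_diff_def)

lemma energy_form_nonneg: "0 \<le> energy_form \<Omega> A v v"
  unfolding energy_form_def
proof (rule integral_nonneg_AE)
  show "AE x in lebesgue_on \<Omega>. 0 \<le> (A x *v weak_gradient \<Omega> v x) \<bullet> weak_gradient \<Omega> v x"
    using diffusion_coefficient_nonneg[OF A] by eventually_elim blast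
qed

lemma energy_norm_square: "(energy_norm \<Omega> A v)\<^sup>2 = energy_form \<Omega> A v v"
  by (simp add: energy_norm_def energy_form_nonneg)

lemma energy_norm_nonneg: "0 \<le> energy_norm \<Omega> A v"
  by (simp add: energy_norm_def energy_form_nonneg)

lemma energy_norm_square_lincomb:
  assumes "v \<in> H1 \<Omega>" "w \<in> H1 \<Omega>"
  shows "(energy_norm \<Omega> A (\<lambda>x. v x + c * w x))\<^sup>2
    = (energy_norm \<Omega> A v)\<^sup>2 + 2 * c * energy_form \<Omega> A v w + c\<^sup>2 * (energy_norm \<Omega> A w)\<^sup>2"
proof -
  let ?u = "\<lambda>x. v x + c * w x" and ?a = "energy_form \<Omega> A"
  note comb = H1_lincomb(1)[OF \<Omega> assms, of c]
  have "?a ?u ?u = ?a v ?u + c * ?a w ?u" by (rule energy_form_lincomb[OF assms comb])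
  also have "?a v ?u = ?a ?u v" by (rule energy_form_symmetric[OF assms(1) comb])
  also have "?a w ?u = ?a ?u w" by (rule energy_form_symmetric[OF assms(2) comb])
  also have "?a ?u v = ?a v v + c * ?a w v" by (rule energy_form_lincomb[OF assms assms(1)])
  also have "?a ?u w = ?a v w + c * ?a w w" by (rule energy_form_lincomb[OF assms assms(2)])
  also have "?a w v = ?a v w" by (rule energy_form_symmetric[OF assms(2,1)])
  finally show ?thesis
    unfolding energy_norm_square by (simp add: algebra_simps power2_eq_square)
qed

lemma energy_form_Cauchy_Schwarz:
  assumes "v \<in> H1 \<Omega>" "w \<in> H1 \<Omega>"
  shows "\<bar>energy_form \<Omega> A v w\<bar> \<le> energy_norm \<Omega> A v * energy_norm \<Omega> A w"
proof -
  have "(energy_form \<Omega> A v w)\<^sup>2 \<le> (energy_norm \<Omega> A v)\<^sup>2 * (energy_norm \<Omega> A w)\<^sup>2"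
  proof (rule discriminant_nonneg_quadratic)
    show "0 \<le> (energy_norm \<Omega> A v)\<^sup>2 + 2 * t * energy_form \<Omega> A v w + t\<^sup>2 * (energy_norm \<Omega> A w)\<^sup>2" for t
      unfolding energy_norm_square_lincomb[OF assms, symmetric] by (rule zero_le_power2)
  qed (rule zero_le_power2)
  then have "\<bar>energy_form \<Omega> A v w\<bar>\<^sup>2 \<le> (energy_norm \<Omega> A v * energy_norm \<Omega> A w)\<^sup>2"
    by (simp only: power2_abs power_mult_distrib)
  then show ?thesis
    by (rule power2_le_imp_le) (intro mult_nonneg_nonneg energy_norm_nonneg)
qed

lemma energy_norm_triangle:
  assumes "u \<in> H1 \<Omega>" "v \<in> H1 \<Omega>" "w \<in> H1 \<Omega>"
  shows "energy_norm \<Omega> A (u - w) \<le> energy_norm \<Omega> A (u - v) + energy_norm \<Omega> A (v - w)"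
proof -
  note H = H1_diff[OF \<Omega> assms(1,2)] H1_diff[OF \<Omega> assms(2,3)]
  have eq: "(\<lambda>x. (u - v) x + 1 * (v - w) x) = u - w" by (rule ext) simp
  have "(energy_norm \<Omega> A (u - w))\<^sup>2
      = (energy_norm \<Omega> A (u - v))\<^sup>2 + 2 * energy_form \<Omega> A (u - v) (v - w) + (energy_norm \<Omega> A (v - w))\<^sup>2"
    using energy_norm_square_lincomb[OF H, of 1] unfolding eq by simp
  also have "\<dots> \<le> (energy_norm \<Omega> A (u - v) + energy_norm \<Omega> A (v - w))\<^sup>2"
    using abs_le_D1[OF energy_form_Cauchy_Schwarz[OF H]] unfolding power2_sum by linarith
  finally show ?thesis by (rule power2_le_imp_le) (intro add_nonneg_nonneg energy_norm_nonneg)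
qed

lemma energy_norm_diff_commute:
  assumes "v \<in> H1 \<Omega>" "w \<in> H1 \<Omega>"
  shows "energy_norm \<Omega> A (v - w) = energy_norm \<Omega> A (w - v)"
proof -
  have eq: "(\<lambda>x. a x + - 1 * b x) = a - b" for a b :: "real^'n \<Rightarrow> real"
    by (rule ext) simp
  have "(energy_norm \<Omega> A (v - w))\<^sup>2 = (energy_norm \<Omega> A (w - v))\<^sup>2"
    using energy_norm_square_lincomb[OF assms, of "-1"] energy_norm_square_lincomb[OF assms(2,1), of "-1"]
    unfolding eq energy_form_symmetric[OF assms] by simp
  then show ?thesis by (rule power2_eq_imp_eq) (rule energy_norm_nonneg)+
qed

lemma energy_norm_diff_self:
  assumes "v \<in> H1 \<Omega>" shows "energy_norm \<Omega> A (v - v) = 0"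
  unfolding energy_norm_def energy_form_diff[OF assms assms H1_diff[OF \<Omega> assms assms]] by simp

text \<open>Testing both Galerkin equations with elements of the smaller space shows that \<open>u - v\<close> is orthogonal to
  \<open>v - w\<close>.\<close>

lemma galerkin_pythagoras:
  assumes u: "galerkin_solution \<Omega> A F V u" and v: "galerkin_solution \<Omega> A F W v"
    and w: "galerkin_solution \<Omega> A F W' w" and sub: "W' \<subseteq> W" "W \<subseteq> V" "V \<subseteq> H1 \<Omega>"
  shows "(energy_norm \<Omega> A (u - v))\<^sup>2 + (energy_norm \<Omega> A (v - w))\<^sup>2 = (energy_norm \<Omega> A (u - w))\<^sup>2"
proof -
  have H: "u \<in> H1 \<Omega>" "v \<in> H1 \<Omega>" "w \<in> H1 \<Omega>" and W: "v \<in> W" "w \<in> W"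
    using u v w sub unfolding galerkin_solution_def by blast+
  have eq: "(\<lambda>x. (u - v) x + 1 * (v - w) x) = u - w" by (rule ext) simp
  note D = H1_diff[OF \<Omega> H(1,2)] H1_diff[OF \<Omega> H(2,3)]
  have orth: "energy_form \<Omega> A (u - v) y = 0" if "y \<in> W" "y \<in> H1 \<Omega>" for y
  proof -
    have "energy_form \<Omega> A u y = F y" "energy_form \<Omega> A v y = F y"
      using u v that sub unfolding galerkin_solution_def by blast+
    then show ?thesis by (simp add: energy_form_diff[OF H(1,2) that(2)])
  qed
  have "energy_form \<Omega> A (u - v) (v - w) = energy_form \<Omega> A (v - w) (u - v)"
    by (rule energy_form_symmetric[OF D])
  also have "\<dots> = energy_form \<Omega> A v (u - v) - energy_form \<Omega> A w (u - v)"
    by (rule energy_form_diff[OF H(2,3) D(1)])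
  also have "\<dots> = 0"
    using orth W H by (simp only: energy_form_symmetric[OF H(2) D(1)] energy_form_symmetric[OF H(3) D(1)] diff_self)
  finally have "energy_form \<Omega> A (u - v) (v - w) = 0" .
  then show ?thesis
    using energy_norm_square_lincomb[OF D, of 1] \<open>energy_form \<Omega> A (u - v) (v - w) = 0\<close>
    unfolding eq by simp
qed

end

section \<open>Refined meshes and nested spaces\<close>

lemma child_length:
  fixes T :: "'n::finite tagged_simplex"
  assumes "2 \<le> length (fst T)" "c \<in> children T"
  shows "length (fst c) = length (fst T)"
  using assms by (cases T) (auto simp: children_def Let_def)

text \<open>The new vertex is the midpoint of an edge of the parent, so all vertices of a child lie in the
  convex hull of the vertices of the parent.\<close>

lemma child_subset:
  fixes T :: "'n::finite tagged_simplex"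
  assumes "2 \<le> length (fst T)" "c \<in> children T"
  shows "elem c \<subseteq> elem T"
proof -
  obtain xs \<gamma> where T: "T = (xs, \<gamma>)" by (cases T)
  have xs: "xs \<noteq> []" using assms(1) T by auto
  let ?m = "midpoint (hd xs) (last xs)" and ?inner = "butlast (tl xs)"
  have ends: "hd xs \<in> set xs" "last xs \<in> set xs" using xs by auto
  have inner: "set ?inner \<subseteq> set xs"
    using xs by (meson in_set_butlastD list.set_sel(2) subsetI)
  have "?m \<in> convex hull {hd xs, last xs}"
    by (simp flip: segment_convex_hull)
  then have m: "?m \<in> convex hull (set xs)"
    using ends hull_mono[of "{hd xs, last xs}" "set xs" convex] by auto
  have "set (take \<gamma> ?inner) \<subseteq> set xs" "set (drop \<gamma> ?inner) \<subseteq> set xs"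
    using inner set_take_subset[of \<gamma> ?inner] set_drop_subset[of \<gamma> ?inner] by blast+
  then have "vertices c \<subseteq> insert ?m (set xs)"
    using assms(2) ends inner
    by (auto simp add: T children_def Let_def vertices_def subset_iff)
  also have "\<dots> \<subseteq> convex hull (set xs)"
    using m hull_subset[of "set xs" convex] by blast
  finally show ?thesis
    unfolding elem_def T by (simp add: vertices_def hull_minimal)
qed

text \<open>Children lie inside their parent only if the vertex list of the parent has separate first and last
  entries, so this property is carried along.\<close>

lemma nvb_refinement_invariant:
  fixes \<T> :: "'n::finite tagged_simplex set"
  assumes "nvb_refinement \<T> \<S>" "finite \<T>" "\<forall>T\<in>\<T>. 2 \<le> length (fst T)"
  shows "finite \<S>" "\<forall>T\<in>\<S>. 2 \<le> length (fst T)" "\<forall>S\<in>\<S>. \<exists>T\<in>\<T>. elem S \<subseteq> elem T"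
proof -
  have "finite \<S> \<and> (\<forall>T\<in>\<S>. 2 \<le> length (fst T)) \<and> (\<forall>S\<in>\<S>. \<exists>T\<in>\<T>. elem S \<subseteq> elem T)"
    using assms(1)
  proof (induction rule: rtranclp_induct)
    case base
    then show ?case using assms by blast
  next
    case (step \<S> \<S>')
    then obtain T where T: "T \<in> \<S>" "\<S>' = (\<S> - {T}) \<union> children T"
      by (auto simp: bisection_step_def)
    have "finite (children T)" by (cases T) (simp add: children_def Let_def)
    moreover have "2 \<le> length (fst T)" using T step.IH by blast
    moreover have "\<exists>R\<in>\<T>. elem S \<subseteq> elem R" if S: "S \<in> \<S>'" for S
    proof (cases "S \<in> \<S>")
      case False
      then have "elem S \<subseteq> elem T"
        using S T(2) \<open>2 \<le> length (fst T)\<close> by (intro child_subset) auto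
      then show ?thesis using step.IH T(1) by (meson order_trans)
    qed (use step.IH in blast)
    moreover have "2 \<le> length (fst S)" if "S \<in> \<S>'" for S
    proof (cases "S \<in> \<S>")
      case False
      then show ?thesis
        using that T(2) \<open>2 \<le> length (fst T)\<close> child_length[of T S] by simp
    qed (use step.IH in blast)
    ultimately show ?case using T(2) step.IH by simp
  qed
  then show "finite \<S>" "\<forall>T\<in>\<S>. 2 \<le> length (fst T)" "\<forall>S\<in>\<S>. \<exists>T\<in>\<T>. elem S \<subseteq> elem T"
    by blast+
qed

lemma refinements_nvb_refinement:
  assumes "\<T>' \<in> refinements \<T>" shows "nvb_refinement \<T> \<T>'"
  using assms
proof induction
  case (step \<T>' \<M> \<T>'')
  then have "nvb_refinement \<T>' \<T>''" unfolding is_refine_def conforming_refinements_def by blast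
  with step.IH show ?case by (rule rtranclp_trans)
qed (rule rtranclp.rtrancl_refl)

lemma mem_fe_space:
  "v \<in> fe_space \<Omega> p \<T> \<longleftrightarrow>
     v \<in> H10 \<Omega> \<and> (\<forall>T\<in>\<T>. \<exists>q. polynomial_of_degree_le p q \<and> (\<forall>x\<in>elem T. v x = q x))"
  unfolding fe_space_def by (rule mem_Collect_eq)

lemma fe_space_nested:
  assumes "\<forall>S\<in>\<S>. \<exists>T\<in>\<T>. elem S \<subseteq> elem T"
  shows "fe_space \<Omega> p \<T> \<subseteq> fe_space \<Omega> p \<S>"
proof
  fix v assume v: "v \<in> fe_space \<Omega> p \<T>"
  have "\<exists>q. polynomial_of_degree_le p q \<and> (\<forall>x\<in>elem S. v x = q x)" if S: "S \<in> \<S>" for S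
  proof -
    obtain T where T: "T \<in> \<T>" "elem S \<subseteq> elem T" using bspec[OF assms S] by (rule bexE)
    have "\<exists>q. polynomial_of_degree_le p q \<and> (\<forall>x\<in>elem T. v x = q x)"
      using conjunct2[OF v[unfolded mem_fe_space]] T(1) by (rule bspec)
    then show ?thesis
    proof (elim exE conjE)
      fix q assume q: "polynomial_of_degree_le p q" "\<forall>x\<in>elem T. v x = q x"
      have "\<forall>x\<in>elem S. v x = q x"
      proof
        fix x assume "x \<in> elem S"
        then have "x \<in> elem T" using T(2) by (rule subsetD[rotated])
        with q(2) show "v x = q x" by (rule bspec)
      qed
      from conjI[OF q(1) this] show ?thesis by (rule exI[of _ q])
    qed
  qed
  then show "v \<in> fe_space \<Omega> p \<S>"
    using conjunct1[OF v[unfolded mem_fe_space]] unfolding mem_fe_space by (intro conjI ballI)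
qed

lemma H10_subset_H1: "H10 \<Omega> \<subseteq> H1 \<Omega>"
  unfolding H10_def by (rule Collect_restrict)

lemma fe_space_subset_H10: "fe_space \<Omega> p \<T> \<subseteq> H10 \<Omega>"
  unfolding fe_space_def by (rule Collect_restrict)

lemma zero_in_fe_space:
  fixes \<Omega> :: "(real^'n::finite) set"
  assumes "open \<Omega>" "bounded \<Omega>"
  shows "(\<lambda>x. 0) \<in> fe_space \<Omega> p \<T>"
proof -
  have "polynomial_of_degree_le p (\<lambda>x::real^'n. 0)"
    unfolding polynomial_of_degree_le_def by (rule exI[of _ "\<lambda>_. 0"]) simp
  then have "\<exists>q. polynomial_of_degree_le p q \<and> (\<forall>x\<in>elem T. 0 = q x)" for T :: "'n tagged_simplex"
    by (intro exI[of _ "\<lambda>x. 0"]) simp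
  then show ?thesis
    using zero_in_H10[OF assms] unfolding mem_fe_space by (intro conjI ballI)
qed

section \<open>The residual estimator\<close>

lemma facet_integral_nonneg: "(\<And>x. 0 \<le> g x) \<Longrightarrow> 0 \<le> facet_integral E g"
  by (simp add: facet_integral_def)

lemma eta_sq_nonneg: "0 \<le> eta_sq A f ff \<T> v T"
  unfolding eta_sq_def
  by (intro add_nonneg_nonneg mult_nonneg_nonneg powr_ge_zero sum_nonneg facet_integral_nonneg
      Bochner_Integration.integral_nonneg zero_le_power2)

lemma eta_nonneg: "0 \<le> eta A f ff \<T> \<U> v"
  by (simp add: eta_def eta_sq_nonneg sum_nonneg)

lemma eta_square_Un:
  assumes "finite \<U>" "finite \<U>'" "\<U> \<inter> \<U>' = {}"
  shows "(eta A f ff \<T> (\<U> \<union> \<U>') v)\<^sup>2 = (eta A f ff \<T> \<U> v)\<^sup>2 + (eta A f ff \<T> \<U>' v)\<^sup>2"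
  using assms by (simp add: eta_def eta_sq_nonneg sum_nonneg sum.union_disjoint)

lemma eta_mono:
  assumes "finite \<U>'" "\<U> \<subseteq> \<U>'"
  shows "eta A f ff \<T> \<U> v \<le> eta A f ff \<T> \<U>' v"
  using assms by (simp add: eta_def eta_sq_nonneg sum_mono2)

text \<open>The estimator is unchanged on the common elements and shrinks by the factor \<open>q\<close> on the rest. Since all
  marked elements are refined, the rest carries at least the fraction \<open>\<theta>\<close> of the squared estimator.\<close>

lemma doerfler_reduction:
  assumes fin: "finite \<T>" "finite \<T>'"
    and unrefined: "eta A f ff \<T>' (\<T> \<inter> \<T>') v = eta A f ff \<T> (\<T> \<inter> \<T>') v"
    and refined: "eta A f ff \<T>' (\<T>' - \<T>) v \<le> q * eta A f ff \<T> (\<T> - \<T>') v"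
    and q: "0 < q" "q < 1" and \<theta>: "\<theta> \<le> 1"
    and mark: "doerfler_marking \<theta> \<T> (\<lambda>\<U>. eta A f ff \<T> \<U> v) \<M>" "\<M> \<inter> \<T>' = {}"
  shows "eta A f ff \<T>' \<T>' v \<le> sqrt (1 - (1 - q\<^sup>2) * \<theta>) * eta A f ff \<T> \<T> v"
proof (rule power2_le_imp_le)
  let ?e = "\<lambda>\<U>. (eta A f ff \<T> \<U> v)\<^sup>2"
  have q2: "q\<^sup>2 < 1" using q by (simp add: abs_square_less_1)
  then have "(1 - q\<^sup>2) * \<theta> \<le> (1 - q\<^sup>2) * 1" using \<theta> by (intro mult_left_mono) auto
  also have "\<dots> \<le> 1" by simp
  finally have nonneg: "0 \<le> 1 - (1 - q\<^sup>2) * \<theta>" by simp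
  have "\<theta> * ?e \<T> \<le> ?e \<M>" "\<M> \<subseteq> \<T>" using mark(1) unfolding doerfler_marking_def by simp_all
  moreover have "?e \<M> \<le> ?e (\<T> - \<T>')"
    using fin mark(2) \<open>\<M> \<subseteq> \<T>\<close> by (intro power_mono eta_mono eta_nonneg) auto
  ultimately have marked: "(1 - q\<^sup>2) * (\<theta> * ?e \<T>) \<le> (1 - q\<^sup>2) * ?e (\<T> - \<T>')"
    using q2 by (intro mult_left_mono) auto
  have split: "?e \<T> = ?e (\<T> \<inter> \<T>') + ?e (\<T> - \<T>')"
    using eta_square_Un[OF finite_Int[OF disjI1] finite_Diff Int_Diff_disjoint, OF fin(1) fin(1)]
    unfolding Int_Diff_Un .
  have "\<T>' = (\<T> \<inter> \<T>') \<union> (\<T>' - \<T>)" by blast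
  then have "(eta A f ff \<T>' \<T>' v)\<^sup>2 = (eta A f ff \<T>' ((\<T> \<inter> \<T>') \<union> (\<T>' - \<T>)) v)\<^sup>2"
    by (rule arg_cong[where f = "\<lambda>\<U>. (eta A f ff \<T>' \<U> v)\<^sup>2"])
  also have "\<dots> = ?e (\<T> \<inter> \<T>') + (eta A f ff \<T>' (\<T>' - \<T>) v)\<^sup>2"
    using fin unfolding unrefined[symmetric] by (intro eta_square_Un) auto
  also have "\<dots> \<le> ?e (\<T> \<inter> \<T>') + (q * eta A f ff \<T> (\<T> - \<T>') v)\<^sup>2"
    by (intro add_left_mono power_mono refined eta_nonneg)
  also have "\<dots> = ?e \<T> - (1 - q\<^sup>2) * ?e (\<T> - \<T>')"
    unfolding split power_mult_distrib by (simp add: left_diff_distrib)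
  also have "\<dots> \<le> ?e \<T> - (1 - q\<^sup>2) * (\<theta> * ?e \<T>)" by (rule diff_left_mono[OF marked])
  also have "\<dots> = (1 - (1 - q\<^sup>2) * \<theta>) * ?e \<T>" by (simp add: left_diff_distrib)
  also have "\<dots> = (sqrt (1 - (1 - q\<^sup>2) * \<theta>) * eta A f ff \<T> \<T> v)\<^sup>2"
    using nonneg by (simp add: power_mult_distrib)
  finally show "(eta A f ff \<T>' \<T>' v)\<^sup>2 \<le> (sqrt (1 - (1 - q\<^sup>2) * \<theta>) * eta A f ff \<T> \<T> v)\<^sup>2" .
  show "0 \<le> sqrt (1 - (1 - q\<^sup>2) * \<theta>) * eta A f ff \<T> \<T> v"
    using nonneg by (intro mult_nonneg_nonneg eta_nonneg) auto
qed


section \<open>Linear convergence of an abstract quasi-error\<close>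

lemma index_last:
  assumes "level_reached kk l" "kk l = enat m" shows "(l, m) \<in> index_set kk"
  using assms by (simp add: index_set_def)

text \<open>The properties of a run of the algorithm that linear convergence rests on: \<open>e\<close> is the algebraic error,
  \<open>h\<close> the estimator, \<open>z\<close> the error of the exact discrete solution and \<open>d\<close> the distance of consecutive exact
  discrete solutions. In this order the clauses are nonnegativity, at least one solver step per level,
  contraction of the solver, stability, failure of the stopping criterion before the last step, nested
  iteration with estimator reduction and Galerkin orthogonality, and reliability combined with
  stability.\<close>

definition quasi_error_recursion ::
    "real \<Rightarrow> real \<Rightarrow> real \<Rightarrow> real \<Rightarrow> real \<Rightarrow> (nat \<Rightarrow> enat) \<Rightarrow> (nat \<Rightarrow> nat \<Rightarrow> real) \<Rightarrow> (nat \<Rightarrow> nat \<Rightarrow> real) \<Rightarrow>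
     (nat \<Rightarrow> real) \<Rightarrow> (nat \<Rightarrow> real) \<Rightarrow> bool" where
  "quasi_error_recursion q cs lam qth cr kk e h z d \<longleftrightarrow>
     (\<forall>l k. 0 \<le> e l k \<and> 0 \<le> h l k \<and> 0 \<le> z l \<and> 0 \<le> d l) \<and>
     (\<forall>l. level_reached kk l \<longrightarrow> 1 \<le> kk l) \<and>
     (\<forall>l k. level_reached kk l \<and> enat (Suc k) \<le> kk l \<longrightarrow> e l (Suc k) \<le> q * e l k) \<and>
     (\<forall>l k j. (l, k) \<in> index_set kk \<and> (l, j) \<in> index_set kk \<longrightarrow> h l k \<le> h l j + cs * (e l k + e l j)) \<and>
     (\<forall>l k. level_reached kk l \<and> enat (Suc k) < kk l \<longrightarrow> lam * h l (Suc k) \<le> e l (Suc k) + e l k) \<and>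
     (\<forall>l m. level_reached kk l \<and> kk l = enat m \<longrightarrow>
        e (Suc l) 0 \<le> e l m + d l \<and> h (Suc l) 0 \<le> qth * h l m \<and> (z (Suc l))\<^sup>2 + (d l)\<^sup>2 = (z l)\<^sup>2) \<and>
     (\<forall>l k. (l, k) \<in> index_set kk \<longrightarrow> z l \<le> cr * (h l k + cs * e l k))"

text \<open>For large \<open>n\<close> half of the geometric decay pays for the constant \<open>D\<close>, which leaves the rate \<open>sqrt q\<close>. For
  the finitely many other \<open>n\<close> the constant \<open>\<kappa> < 1\<close> is spread over \<open>n + 1\<close> factors by Bernoulli's inequality.\<close>

lemma min_const_geometric_le_geometric:
  fixes \<kappa> q D :: real
  assumes "0 < \<kappa>" "\<kappa> < 1" "0 < q" "q < 1" "0 < D"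
  obtains \<sigma> where "0 < \<sigma>" "\<sigma> < 1" "q \<le> \<sigma>" "\<And>n. min \<kappa> (D * q ^ n) \<le> \<sigma> ^ Suc n"
proof -
  define r where "r = sqrt q"
  have r: "0 < r" "r < 1" "q = r * r" using assms by (auto simp: r_def)
  have "(\<lambda>n. D * r ^ n) \<longlonglongrightarrow> D * 0"
    by (intro tendsto_intros LIMSEQ_realpow_zero) (use r in auto)
  then have "eventually (\<lambda>n. D * r ^ n < r) sequentially"
    by (rule order_tendstoD) (use r in auto)
  then obtain N where N: "\<And>n. N \<le> n \<Longrightarrow> D * r ^ n < r"
    by (auto simp: eventually_sequentially)
  define x where "x = (1 - \<kappa>) / (real N + 1)"
  have x: "0 < x" "x < 1" "(real N + 1) * x = 1 - \<kappa>"
    using assms by (auto simp: x_def field_simps add_strict_increasing2)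
  define \<sigma> where "\<sigma> = max r (1 - x)"
  have s: "0 < \<sigma>" "\<sigma> < 1" "r \<le> \<sigma>" "1 - x \<le> \<sigma>" using r x by (auto simp: \<sigma>_def)
  have "r * r \<le> 1 * r" using r by (intro mult_right_mono) auto
  then have "q \<le> \<sigma>" using r s by linarith
  moreover have "min \<kappa> (D * q ^ n) \<le> \<sigma> ^ Suc n" for n
  proof (cases "N \<le> n")
    case True
    have "D * q ^ n = D * r ^ n * r ^ n" by (simp add: r(3) power_mult_distrib)
    also have "\<dots> \<le> r * r ^ n" using N[OF True] r by (intro mult_right_mono) auto
    also have "\<dots> \<le> \<sigma> ^ Suc n" using power_mono[OF s(3), of "Suc n"] r by simp
    finally show ?thesis by simp
  next
    case False
    then have "real (Suc n) * x \<le> (real N + 1) * x" using x by (intro mult_right_mono) auto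
    then have "\<kappa> \<le> 1 + real (Suc n) * (- x)" using x by simp
    also have "\<dots> \<le> (1 + - x) ^ Suc n" by (rule Bernoulli_inequality) (use x in simp)
    also have "\<dots> \<le> \<sigma> ^ Suc n" by (rule power_mono) (use s x in auto)
    finally show ?thesis by simp
  qed
  ultimately show ?thesis using that s by blast
qed

context
  fixes q cs lam qth cr :: real and kk :: "nat \<Rightarrow> enat"
    and e h :: "nat \<Rightarrow> nat \<Rightarrow> real" and z d :: "nat \<Rightarrow> real"
  assumes q: "0 < q" "q < 1" and cs: "0 < cs" and lam: "0 < lam" and qth: "0 < qth" "qth < 1" and cr: "0 < cr"
    and rec: "quasi_error_recursion q cs lam qth cr kk e h z d"
begin

lemma rec_nonneg: "0 \<le> e l k" "0 \<le> h l k" "0 \<le> z l" "0 \<le> d l"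
  and rec_kk: "level_reached kk l \<Longrightarrow> 1 \<le> kk l"
  and rec_contract: "level_reached kk l \<Longrightarrow> enat (Suc k) \<le> kk l \<Longrightarrow> e l (Suc k) \<le> q * e l k"
  and rec_stable: "(l, k) \<in> index_set kk \<Longrightarrow> (l, j) \<in> index_set kk \<Longrightarrow> h l k \<le> h l j + cs * (e l k + e l j)"
  and rec_nonstop: "level_reached kk l \<Longrightarrow> enat (Suc k) < kk l \<Longrightarrow> lam * h l (Suc k) \<le> e l (Suc k) + e l k"
  and rec_next: "level_reached kk l \<Longrightarrow> kk l = enat m \<Longrightarrow>
        e (Suc l) 0 \<le> e l m + d l \<and> h (Suc l) 0 \<le> qth * h l m \<and> (z (Suc l))\<^sup>2 + (d l)\<^sup>2 = (z l)\<^sup>2"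
  and rec_reliable: "(l, k) \<in> index_set kk \<Longrightarrow> z l \<le> cr * (h l k + cs * e l k)"
  using rec unfolding quasi_error_recursion_def by blast+

lemma error_decay:
  assumes "level_reached kk l" "enat k \<le> kk l" "j \<le> k"
  shows "e l k \<le> q ^ (k - j) * e l j"
  using \<open>j \<le> k\<close> assms(2)
proof (induction k rule: dec_induct)
  case base
  then show ?case by simp
next
  case (step n)
  have "enat n \<le> kk l" using step.prems by (metis Suc_ile_eq less_imp_le)
  then have "e l (Suc n) \<le> q * (q ^ (n - j) * e l j)"
    using rec_contract[OF assms(1) step.prems] step.IH q
    by (meson less_imp_le mult_left_mono order_trans)
  then show ?case using step.hyps by (simp add: Suc_diff_le)
qed

definition level_const :: real where
  "level_const = (1 + 2 * cs) * (1 + 2 / (lam * q)) / q"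

lemma level_const_ge: "1 \<le> level_const"
proof -
  have "1 * 1 \<le> (1 + 2 * cs) * (1 + 2 / (lam * q))"
    using q cs lam by (intro mult_mono) auto
  then show ?thesis using q by (simp add: level_const_def)
qed

text \<open>Without a stop at \<open>k\<close> the estimator is bounded by the last increment of the solver, hence by the
  algebraic error of the previous step. This makes the estimator decay although its mesh is fixed.\<close>

lemma decay_before_stop:
  assumes "level_reached kk l" "enat k < kk l" "j \<le> k"
  shows "e l k + h l k \<le> (1 + 2 / (lam * q)) * q ^ (k - j) * (e l j + h l j)"
proof (cases "k = j")
  case True
  have "1 * (e l j + h l j) \<le> (1 + 2 / (lam * q)) * (e l j + h l j)"
    using q lam rec_nonneg(1,2)[of l j] by (intro mult_right_mono) auto
  then show ?thesis using True by simp
next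
  case False
  then obtain i where i: "k = Suc i" "j \<le> i" using assms(3) by (cases k) auto
  have le: "enat k \<le> kk l" "enat i \<le> kk l"
    using assms(2) i by (auto simp: order_less_imp_le) (metis Suc_ile_eq less_imp_le)
  have ei: "e l i \<le> q ^ (i - j) * e l j" by (rule error_decay) (use assms i le in auto)
  have ek: "e l k \<le> q ^ (k - j) * e l j" by (rule error_decay) (use assms le in auto)
  have "lam * h l k \<le> e l k + e l i"
    using rec_nonstop[OF assms(1), of i] assms(2) i by simp
  also have "\<dots> \<le> 2 * e l i"
    using rec_contract[OF assms(1), of i] le i q rec_nonneg(1)[of l i]
      mult_right_mono[of q 1 "e l i"] by simp
  also have "\<dots> \<le> 2 * (q ^ (i - j) * e l j)" using ei by simp
  finally have "h l k \<le> 2 / lam * (q ^ (i - j) * e l j)"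
    using lam by (simp add: field_simps)
  also have "q ^ (i - j) = q ^ (k - j) / q"
    using i q by (simp add: Suc_diff_le)
  finally have "e l k + h l k \<le> q ^ (k - j) * e l j + 2 / lam * (q ^ (k - j) / q * e l j)"
    using ek by linarith
  also have "\<dots> = (1 + 2 / (lam * q)) * q ^ (k - j) * e l j"
    by (simp add: algebra_simps)
  also have "\<dots> \<le> (1 + 2 / (lam * q)) * q ^ (k - j) * (e l j + h l j)"
    using q lam rec_nonneg(1,2)[of l j] by (intro mult_left_mono) auto
  finally show ?thesis .
qed

text \<open>The last step of a level is the one at which the stopping criterion holds, so the previous argument
  stops one step earlier. Stability bridges this step at the price of a constant.\<close>

lemma decay_on_level:
  assumes "level_reached kk l" "enat k \<le> kk l" "j \<le> k"
  shows "e l k + h l k \<le> level_const * q ^ (k - j) * (e l j + h l j)"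
proof -
  let ?c = "1 + 2 / (lam * q)" and ?H = "e l j + h l j"
  have H: "0 \<le> ?H" using rec_nonneg(1,2)[of l j] by simp
  have c: "0 \<le> ?c" using lam q by simp
  consider "k = j" | "enat k < kk l" | "enat k = kk l" "j < k"
    using assms by (metis order_le_less)
  then show ?thesis
  proof cases
    case 1
    then show ?thesis using mult_right_mono[OF level_const_ge H] by simp
  next
    case 2
    have "?c \<le> level_const"
    proof -
      have "1 * ?c \<le> (1 + 2 * cs) / q * ?c"
        using q cs c by (intro mult_right_mono) auto
      then show ?thesis by (simp add: level_const_def)
    qed
    then have "?c * q ^ (k - j) * ?H \<le> level_const * q ^ (k - j) * ?H"
      using q H by (intro mult_right_mono) auto
    then show ?thesis using decay_before_stop[OF assms(1) 2 assms(3)] by linarith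
  next
    case 3
    then obtain i where i: "k = Suc i" "j \<le> i" by (cases k) auto
    have lt: "enat i < kk l" using 3 i by (metis enat_ord_simps(2) lessI)
    have idx: "(l, k) \<in> index_set kk" "(l, i) \<in> index_set kk"
      using assms lt by (auto simp: index_set_def)
    have ek: "e l k \<le> e l i"
      using rec_contract[OF assms(1), of i] assms i q rec_nonneg(1)[of l i]
        mult_right_mono[of q 1 "e l i"] by simp
    have "cs * (e l k + e l i) \<le> cs * (2 * e l i)" using cs ek by (intro mult_left_mono) auto
    then have "e l k + h l k \<le> (1 + 2 * cs) * e l i + h l i"
      using rec_stable[OF idx] ek by (simp add: algebra_simps)
    also have "\<dots> \<le> (1 + 2 * cs) * (e l i + h l i)"
      using cs rec_nonneg(2)[of l i] by (simp add: algebra_simps)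
    also have "\<dots> \<le> (1 + 2 * cs) * (?c * q ^ (i - j) * ?H)"
      using decay_before_stop[OF assms(1) lt i(2)] cs by (intro mult_left_mono) auto
    also have "q ^ (i - j) = q ^ (k - j) / q"
      using i q by (simp add: Suc_diff_le)
    finally show ?thesis by (simp add: level_const_def mult_ac)
  qed
qed

definition jump_const :: real where
  "jump_const = 2 + cr * (1 + cs)"

text \<open>Galerkin orthogonality bounds the jump \<open>d l\<close> by \<open>z l\<close>, and reliability bounds \<open>z l\<close> by the
  quasi-error.\<close>

lemma next_level:
  assumes "level_reached kk l" "kk l = enat m"
  shows "e (Suc l) 0 + h (Suc l) 0 \<le> jump_const * (e l m + h l m)"
proof -
  have idx: "(l, m) \<in> index_set kk" using assms by (simp add: index_set_def)
  note n = rec_next[OF assms]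
  have "d l \<le> z l"
  proof (rule power2_le_imp_le)
    show "(d l)\<^sup>2 \<le> (z l)\<^sup>2" using n zero_le_power2[of "z (Suc l)"] by linarith
  qed (rule rec_nonneg)
  also have "\<dots> \<le> cr * (h l m + cs * e l m)" by (rule rec_reliable[OF idx])
  also have "\<dots> \<le> cr * ((1 + cs) * (e l m + h l m))"
    using cr cs rec_nonneg(1,2)[of l m] by (intro mult_left_mono) (simp_all add: algebra_simps)
  finally have "d l \<le> cr * (1 + cs) * (e l m + h l m)" by simp
  moreover have "qth * h l m \<le> h l m"
    using qth rec_nonneg(2)[of l m] mult_right_mono[of qth 1 "h l m"] by simp
  ultimately show ?thesis
    using n rec_nonneg(1,2)[of l m] unfolding jump_const_def by (simp add: algebra_simps)
qed

text \<open>The weight of the estimator is chosen such that \<open>q + 2 weight cs = (1 + q) / 2\<close>. Thus the coupling of the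
  estimator to the algebraic error through stability uses up half of the contraction \<open>1 - q\<close> of the solver.\<close>

definition weight :: real where "weight = (1 - q) / (4 * cs)"
definition rate :: real where "rate = max ((1 + q) / 2) qth"
text \<open>The weight of the squared discretisation error equals the factor in front of \<open>(d l)\<^sup>2\<close> in the Young
  inequality \<open>square_sum_weighted\<close>, so that both combine to \<open>(z (l+1))\<^sup>2 + (d l)\<^sup>2 = (z l)\<^sup>2\<close>.\<close>

definition orth_weight :: real where "orth_weight = rate\<^sup>2 / (1 - rate)"
definition lyapunov :: "nat \<Rightarrow> nat \<Rightarrow> real" where
  "lyapunov l m = (e l m + weight * h l m)\<^sup>2 + orth_weight * (z l)\<^sup>2"
definition rel_const :: real where "rel_const = cr * (1 / weight + cs)"
text \<open>The solution \<open>\<kappa>\<close> of \<open>\<kappa> - rate = (1 - \<kappa>) orth_weight rel_const\<^sup>2\<close>: what is missing for the contraction of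
  \<open>(z l)\<^sup>2\<close> is taken from the surplus in the contraction of the weighted sum.\<close>

definition lyapunov_rate :: real where
  "lyapunov_rate = (rate + orth_weight * rel_const\<^sup>2) / (1 + orth_weight * rel_const\<^sup>2)"

lemma parameters: "0 < weight" "0 < rate" "rate < 1" "0 < orth_weight" "0 < rel_const"
  "0 < lyapunov_rate" "lyapunov_rate < 1"
proof -
  show w: "0 < weight" using q cs by (simp add: weight_def)
  show r: "0 < rate" "rate < 1" using q qth by (auto simp: rate_def)
  show o: "0 < orth_weight" using r by (simp add: orth_weight_def)
  show rc: "0 < rel_const" using w cr cs by (simp add: rel_const_def add_pos_pos)
  have "0 < orth_weight * rel_const\<^sup>2" using o rc by simp
  then show "0 < lyapunov_rate" "lyapunov_rate < 1"
    using r by (auto simp: lyapunov_rate_def add_pos_pos)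
qed

lemma reliable_weighted:
  assumes "(l, k) \<in> index_set kk"
  shows "z l \<le> rel_const * (e l k + weight * h l k)"
proof -
  have "h l k + cs * e l k \<le> (1 / weight + cs) * (e l k + weight * h l k)"
    using parameters(1) cs rec_nonneg(1,2)[of l k] by (simp add: field_simps)
  then show ?thesis
    using rec_reliable[OF assms] cr unfolding rel_const_def
    by (smt (verit, best) mult.assoc mult_left_mono)
qed

text \<open>The algebraic error gains the factor \<open>q\<close> from the at least one solver step, and the estimator gains \<open>qth\<close>
  up to the distance between the old and the new final iterate, which the choice of the weight
  absorbs.\<close>

lemma weighted_step:
  assumes "level_reached kk l" "kk l = enat m" "level_reached kk (Suc l)" "kk (Suc l) = enat m'"
  shows "e (Suc l) m' + weight * h (Suc l) m' \<le> rate * (e l m + weight * h l m + d l)"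
proof -
  note n = rec_next[OF assms(1,2)]
  let ?E = "e (Suc l) 0"
  have m': "1 \<le> m'" using rec_kk[OF assms(3)] assms(4) by (simp add: one_enat_def)
  have "e (Suc l) m' \<le> q ^ m' * ?E"
    using error_decay[OF assms(3), of m' 0] assms(4) by simp
  also have "\<dots> \<le> q ^ 1 * ?E"
    using m' q rec_nonneg(1) by (intro mult_right_mono power_decreasing) auto
  finally have E: "e (Suc l) m' \<le> q * ?E" by simp
  also have "\<dots> \<le> 1 * ?E" using q rec_nonneg(1) by (intro mult_right_mono) auto
  finally have "cs * (e (Suc l) m' + ?E) \<le> cs * (2 * ?E)" using cs by (intro mult_left_mono) auto
  moreover have "(Suc l, m') \<in> index_set kk" "(Suc l, 0) \<in> index_set kk"
    using assms(3,4) by (auto simp: index_set_def)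
  ultimately have "h (Suc l) m' \<le> qth * h l m + 2 * cs * ?E"
    using rec_stable[of "Suc l" m' 0] n by simp
  then have "weight * h (Suc l) m' \<le> weight * (qth * h l m + 2 * cs * ?E)"
    using parameters(1) by (intro mult_left_mono) auto
  moreover have "weight * (2 * cs * ?E) = (1 - q) / 2 * ?E" using cs by (simp add: weight_def)
  ultimately have "e (Suc l) m' + weight * h (Suc l) m' \<le> (1 + q) / 2 * ?E + qth * (weight * h l m)"
    using E by (simp add: algebra_simps add_divide_distrib diff_divide_distrib)
  also have "\<dots> \<le> rate * ?E + rate * (weight * h l m)"
    using rec_nonneg parameters by (intro add_mono mult_right_mono) (auto simp: rate_def)
  also have "\<dots> \<le> rate * (e l m + d l) + rate * (weight * h l m)"
    using n parameters by simp
  finally show ?thesis by (simp add: algebra_simps)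
qed

text \<open>Young's inequality with the parameter that turns the factor \<open>r\<^sup>2\<close> into \<open>r\<close>.\<close>

lemma square_sum_weighted:
  fixes r a b :: real
  assumes "0 < r" "r < 1"
  shows "(r * (a + b))\<^sup>2 \<le> r * a\<^sup>2 + r\<^sup>2 / (1 - r) * b\<^sup>2"
proof -
  have "r * a\<^sup>2 + r\<^sup>2 / (1 - r) * b\<^sup>2 - (r * (a + b))\<^sup>2 = r / (1 - r) * ((1 - r) * a - r * b)\<^sup>2"
    using assms by (simp add: field_simps power2_eq_square)
  also have "0 \<le> \<dots>" using assms by simp
  finally show ?thesis by simp
qed

lemma lyapunov_contracts:
  assumes "level_reached kk l" "kk l = enat m" "level_reached kk (Suc l)" "kk (Suc l) = enat m'"
  shows "lyapunov (Suc l) m' \<le> lyapunov_rate * lyapunov l m"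
proof -
  let ?a = "e l m + weight * h l m"
  have a: "0 \<le> ?a" using parameters rec_nonneg by (simp add: add_nonneg_nonneg)
  note n = rec_next[OF assms(1,2)]
  have "(e (Suc l) m' + weight * h (Suc l) m')\<^sup>2 \<le> (rate * (?a + d l))\<^sup>2"
    using weighted_step[OF assms] parameters rec_nonneg by (intro power_mono) (auto intro!: add_nonneg_nonneg)
  also have "\<dots> \<le> rate * ?a\<^sup>2 + orth_weight * (d l)\<^sup>2"
    unfolding orth_weight_def by (rule square_sum_weighted) (use parameters in auto)
  finally have "lyapunov (Suc l) m' \<le> rate * ?a\<^sup>2 + orth_weight * ((z (Suc l))\<^sup>2 + (d l)\<^sup>2)"
    by (simp add: lyapunov_def algebra_simps)
  also have "\<dots> = rate * ?a\<^sup>2 + orth_weight * (z l)\<^sup>2" using n by simp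
  also have "\<dots> \<le> lyapunov_rate * (?a\<^sup>2 + orth_weight * (z l)\<^sup>2)"
  proof -
    let ?B = "orth_weight * rel_const\<^sup>2"
    have B: "0 < ?B" using parameters by simp
    have "(z l)\<^sup>2 \<le> (rel_const * ?a)\<^sup>2"
      using reliable_weighted[OF index_last[OF assms(1,2)]] rec_nonneg by (intro power_mono) auto
    then have "orth_weight * (z l)\<^sup>2 \<le> ?B * ?a\<^sup>2"
      using parameters by (simp add: power_mult_distrib)
    then have "(1 - rate) * (orth_weight * (z l)\<^sup>2) \<le> (1 - rate) * (?B * ?a\<^sup>2)"
      using parameters by (intro mult_left_mono) auto
    moreover have "(1 + ?B) * lyapunov_rate = rate + ?B"
      using B by (simp add: lyapunov_rate_def)
    ultimately have "(1 + ?B) * (rate * ?a\<^sup>2 + orth_weight * (z l)\<^sup>2)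
        \<le> (1 + ?B) * lyapunov_rate * (?a\<^sup>2 + orth_weight * (z l)\<^sup>2)"
      by (simp add: algebra_simps)
    then show ?thesis using B by (simp add: mult.assoc)
  qed
  finally show ?thesis by (simp add: lyapunov_def)
qed


definition lower_const :: real where "lower_const = 1 / min 1 weight"
definition upper_const :: real where "upper_const = max 1 weight * sqrt (1 + orth_weight * rel_const\<^sup>2)"

lemma equivalence_consts_pos: "0 < lower_const" "0 < upper_const"
  using parameters by (auto simp: lower_const_def upper_const_def intro!: mult_pos_pos add_pos_nonneg)

lemma quasi_error_le_lyapunov: "e l m + h l m \<le> lower_const * sqrt (lyapunov l m)"
proof -
  let ?a = "e l m + weight * h l m"
  have "min 1 weight * (e l m + h l m) \<le> ?a"
    using rec_nonneg(1,2)[of l m] mult_right_mono[of "min 1 weight" 1 "e l m"]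
      mult_right_mono[of "min 1 weight" weight "h l m"] by (simp add: algebra_simps)
  also have "?a \<le> sqrt (?a\<^sup>2)" by simp
  also have "\<dots> \<le> sqrt (lyapunov l m)"
    unfolding lyapunov_def by (rule real_sqrt_le_mono) (use parameters in simp)
  finally show ?thesis using parameters by (simp add: lower_const_def field_simps)
qed

lemma lyapunov_le_quasi_error:
  assumes "(l, m) \<in> index_set kk"
  shows "sqrt (lyapunov l m) \<le> upper_const * (e l m + h l m)"
proof -
  let ?a = "e l m + weight * h l m" and ?B = "orth_weight * rel_const\<^sup>2"
  have a: "0 \<le> ?a" using parameters rec_nonneg by (simp add: add_nonneg_nonneg)
  have "(z l)\<^sup>2 \<le> (rel_const * ?a)\<^sup>2"
    using reliable_weighted[OF assms] rec_nonneg by (intro power_mono) auto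
  then have "orth_weight * (z l)\<^sup>2 \<le> ?B * ?a\<^sup>2"
    using parameters by (simp add: power_mult_distrib)
  then have "lyapunov l m \<le> (1 + ?B) * ?a\<^sup>2"
    by (simp add: lyapunov_def algebra_simps)
  then have "sqrt (lyapunov l m) \<le> sqrt ((1 + ?B) * ?a\<^sup>2)" by simp
  also have "\<dots> = sqrt (1 + ?B) * ?a" using a by (simp add: real_sqrt_mult)
  also have "\<dots> \<le> sqrt (1 + ?B) * (max 1 weight * (e l m + h l m))"
  proof (rule mult_left_mono)
    show "?a \<le> max 1 weight * (e l m + h l m)"
      using rec_nonneg(1,2)[of l m] mult_right_mono[of 1 "max 1 weight" "e l m"]
        mult_right_mono[of weight "max 1 weight" "h l m"] by (simp add: algebra_simps)
    show "0 \<le> sqrt (1 + ?B)" using parameters by simp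
  qed
  finally show ?thesis by (simp add: upper_const_def mult_ac)
qed

definition level_rate_const :: real where
  "level_rate_const = upper_const * level_const * jump_const * lower_const"

lemma jump_const_pos: "0 < jump_const"
  using cr cs by (simp add: jump_const_def add_pos_pos)

lemma level_rate_const_pos: "0 < level_rate_const"
  using equivalence_consts_pos jump_const_pos level_const_ge by (simp add: level_rate_const_def)

lemma lyapunov_nonneg: "0 \<le> lyapunov l m"
  using parameters by (simp add: lyapunov_def)

text \<open>This estimate keeps the full power \<open>q\<^sup>k\<close>, in contrast to \<open>lyapunov_contracts\<close>, which gains a fixed
  factor only.\<close>

lemma quasi_error_across_level:
  assumes "level_reached kk l" "kk l = enat m" "(Suc l, k) \<in> index_set kk"
  shows "e (Suc l) k + h (Suc l) k
    \<le> level_const * jump_const * lower_const * q ^ k * sqrt (lyapunov l m)"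
proof -
  have lc: "0 \<le> level_const * q ^ k" using level_const_ge q by simp
  have "e (Suc l) k + h (Suc l) k \<le> level_const * q ^ k * (e (Suc l) 0 + h (Suc l) 0)"
    using decay_on_level[of "Suc l" k 0] assms(3) by (simp add: index_set_def)
  also have "\<dots> \<le> level_const * q ^ k * (jump_const * (e l m + h l m))"
    by (rule mult_left_mono[OF next_level[OF assms(1,2)] lc])
  also have "\<dots> \<le> level_const * q ^ k * (jump_const * (lower_const * sqrt (lyapunov l m)))"
    using jump_const_pos
    by (intro mult_left_mono[OF _ lc] mult_left_mono[OF quasi_error_le_lyapunov]) simp
  finally show ?thesis by (simp add: mult_ac)
qed

context
  fixes \<sigma> :: real
  assumes \<sigma>: "0 < \<sigma>" "\<sigma> < 1" "q \<le> \<sigma>"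
    and \<sigma>_min: "\<And>n. min (sqrt lyapunov_rate) (level_rate_const * q ^ n) \<le> \<sigma> ^ Suc n"
begin

text \<open>Both available bounds are combined, so that each of the \<open>m' + 1\<close> indices of a level contributes a factor.\<close>

lemma lyapunov_step:
  assumes "level_reached kk l" "kk l = enat m" "level_reached kk (Suc l)" "kk (Suc l) = enat m'"
  shows "sqrt (lyapunov (Suc l) m') \<le> \<sigma> ^ Suc m' * sqrt (lyapunov l m)"
proof -
  let ?Y = "sqrt (lyapunov l m)" and ?Y' = "sqrt (lyapunov (Suc l) m')"
  have Y: "0 \<le> ?Y" by (simp add: lyapunov_nonneg)
  have idx: "(Suc l, m') \<in> index_set kk" by (rule index_last[OF assms(3,4)])
  have 1: "?Y' \<le> sqrt lyapunov_rate * ?Y"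
    using lyapunov_contracts[OF assms] by (simp flip: real_sqrt_mult)
  have "?Y' \<le> upper_const * (e (Suc l) m' + h (Suc l) m')"
    by (rule lyapunov_le_quasi_error[OF idx])
  also have "\<dots> \<le> upper_const * (level_const * jump_const * lower_const * q ^ m' * ?Y)"
    using equivalence_consts_pos by (intro mult_left_mono quasi_error_across_level assms idx) auto
  finally have 2: "?Y' \<le> level_rate_const * q ^ m' * ?Y"
    by (simp add: level_rate_const_def mult_ac)
  have "?Y' \<le> min (sqrt lyapunov_rate) (level_rate_const * q ^ m') * ?Y"
    using 1 2 by (simp add: min_def)
  also have "\<dots> \<le> \<sigma> ^ Suc m' * ?Y" by (rule mult_right_mono[OF \<sigma>_min Y])
  finally show ?thesis .
qed

end

end

text \<open>The number of indices on the levels below \<open>l\<close>. Level \<open>i\<close> contributes its \<open>kk i\<close> solver steps and the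
  initial iterate.\<close>

definition steps_before :: "(nat \<Rightarrow> enat) \<Rightarrow> nat \<Rightarrow> nat" where
  "steps_before kk l = (\<Sum>i<l. Suc (the_enat (kk i)))"

lemma step_count_eq:
  assumes "(l, k) \<in> index_set kk"
  shows "step_count kk l k = steps_before kk l + Suc k"
proof -
  have fin: "kk i = enat (the_enat (kk i))" if "i < l" for i
    using assms that by (auto simp: index_set_def level_reached_def)
  have "{(l', k') \<in> index_set kk. l' < l \<or> l' = l \<and> k' \<le> k}
    = (SIGMA i:{..<l}. {..the_enat (kk i)}) \<union> {l} \<times> {..k}"
  proof (intro equalityI subrelI)
    fix i j assume *: "(i, j) \<in> {(l', k') \<in> index_set kk. l' < l \<or> l' = l \<and> k' \<le> k}"
    show "(i, j) \<in> (SIGMA i:{..<l}. {..the_enat (kk i)}) \<union> {l} \<times> {..k}"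
    proof (cases "i < l")
      case True
      have "enat j \<le> enat (the_enat (kk i))"
        using * unfolding fin[OF True, symmetric] by (simp add: index_set_def)
      then show ?thesis using True by simp
    next
      case False
      then show ?thesis using * by simp
    qed
  next
    fix i j assume *: "(i, j) \<in> (SIGMA i:{..<l}. {..the_enat (kk i)}) \<union> {l} \<times> {..k}"
    have "level_reached kk i"
      using * assms by (auto simp: index_set_def level_reached_def)
    moreover have "enat j \<le> kk i"
    proof (cases "i < l")
      case True
      then have "enat j \<le> enat (the_enat (kk i))" using * by simp
      then show ?thesis using fin[OF True] by simp
    next
      case False
      then have "i = l" "j \<le> k" using * by auto
      then show ?thesis using assms by (auto simp: index_set_def intro: order_trans[rotated])
    qed
    ultimately show "(i, j) \<in> {(l', k') \<in> index_set kk. l' < l \<or> l' = l \<and> k' \<le> k}"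
      using * by (auto simp: index_set_def)
  qed
  then have "step_count kk l k = card ((SIGMA i:{..<l}. {..the_enat (kk i)}) \<union> {l} \<times> {..k})"
    by (simp add: step_count_def)
  also have "\<dots> = card (SIGMA i:{..<l}. {..the_enat (kk i)}) + card ({l} \<times> {..k})"
    by (rule card_Un_disjoint) auto
  finally show ?thesis by (simp add: steps_before_def)
qed

lemma steps_before_mono: "i \<le> j \<Longrightarrow> steps_before kk i \<le> steps_before kk j"
  unfolding steps_before_def by (rule sum_mono2) auto

lemma index_last_le:
  assumes "(l, k) \<in> index_set kk" "kk l = enat m" shows "k \<le> m"
  using assms by (simp add: index_set_def)

text \<open>The step count enumerates the index set in the lexicographic order.\<close>

lemma step_count_le_imp_lex:
  assumes "(l, k) \<in> index_set kk" "(l', k') \<in> index_set kk" "step_count kk l' k' \<le> step_count kk l k"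
  shows "l' < l \<or> l' = l \<and> k' \<le> k"
proof (cases "l < l'")
  case True
  then have "level_reached kk l'" using assms by (simp add: index_set_def)
  with True obtain m where m: "kk l = enat m" by (auto simp: level_reached_def)
  have "steps_before kk l + Suc m \<le> steps_before kk l'"
    using steps_before_mono[of "Suc l" l' kk] True m by (simp add: steps_before_def)
  then show ?thesis
    using assms(3) index_last_le[OF assms(1) m] unfolding step_count_eq[OF assms(1)] step_count_eq[OF assms(2)] by simp
next
  case False
  then show ?thesis
    using assms(3) unfolding step_count_eq[OF assms(1)] step_count_eq[OF assms(2)]
    by (cases "l = l'") auto
qed

lemma level_reached_mono: "level_reached kk l \<Longrightarrow> i \<le> l \<Longrightarrow> level_reached kk i"
  by (simp add: level_reached_def)

context
  fixes q cs lam qth cr :: real and kk :: "nat \<Rightarrow> enat"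
    and e h :: "nat \<Rightarrow> nat \<Rightarrow> real" and z d :: "nat \<Rightarrow> real" and \<sigma> :: real
  assumes q: "0 < q" "q < 1" and cs: "0 < cs" and lam: "0 < lam" and qth: "0 < qth" "qth < 1" and cr: "0 < cr"
    and rec: "quasi_error_recursion q cs lam qth cr kk e h z d"
    and \<sigma>: "0 < \<sigma>" "\<sigma> < 1" "q \<le> \<sigma>"
    and \<sigma>_min: "\<And>n. min (sqrt (lyapunov_rate q cs qth cr)) (level_rate_const q cs lam qth cr * q ^ n) \<le> \<sigma> ^ Suc n"
begin

private abbreviation "Y \<equiv> \<lambda>l. sqrt (lyapunov q cs qth e h z l (the_enat (kk l)))"
private abbreviation "Lc \<equiv> level_const q cs lam"
private abbreviation "Jc \<equiv> jump_const cs cr"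
private abbreviation "lo \<equiv> lower_const q cs"
private abbreviation "up \<equiv> upper_const q cs qth cr"

lemma lyapunov_chain:
  assumes "j \<le> l" "level_reached kk (Suc l)"
  shows "Y l \<le> \<sigma> ^ (steps_before kk (Suc l) - steps_before kk (Suc j)) * Y j"
  using assms
proof (induction l rule: dec_induct)
  case base
  then show ?case by simp
next
  case (step l)
  have reached: "level_reached kk (Suc l)" "level_reached kk l"
    using step.prems by (auto intro: level_reached_mono)
  have fin: "kk (Suc l) = enat (the_enat (kk (Suc l)))" "kk l = enat (the_enat (kk l))"
    using step.prems unfolding level_reached_def
    by (metis the_enat.simps not_infinity_eq lessI, metis the_enat.simps not_infinity_eq less_Suc_eq)
  let ?m = "the_enat (kk (Suc l))"
  have "Y (Suc l) \<le> \<sigma> ^ Suc ?m * Y l"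
    by (rule lyapunov_step[OF q cs lam qth cr rec \<sigma> \<sigma>_min reached(2) fin(2) reached(1) fin(1)])
  also have "\<dots> \<le> \<sigma> ^ Suc ?m * (\<sigma> ^ (steps_before kk (Suc l) - steps_before kk (Suc j)) * Y j)"
    using step.IH[OF reached(1)] \<sigma> by (intro mult_left_mono) auto
  also have "\<dots> = \<sigma> ^ (Suc ?m + (steps_before kk (Suc l) - steps_before kk (Suc j))) * Y j"
    by (simp add: power_add)
  also have "Suc ?m + (steps_before kk (Suc l) - steps_before kk (Suc j))
    = steps_before kk (Suc (Suc l)) - steps_before kk (Suc j)"
    using steps_before_mono[of "Suc j" "Suc l" kk] step.hyps by (simp add: steps_before_def)
  finally show ?case .
qed

definition linear_const :: real where
  "linear_const = Lc + Lc * Jc * lo * up * Lc / \<sigma>"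

lemma linear_const_pos: "0 < linear_const"
  using level_const_ge[OF q cs lam qth cr rec] jump_const_pos[OF q cs lam qth cr rec]
    equivalence_consts_pos[OF q cs lam qth cr rec] \<sigma>(1)
  unfolding linear_const_def by (intro add_pos_nonneg) auto

text \<open>The way from \<open>(l', k')\<close> to \<open>(l, k)\<close> leads over the rest of level \<open>l'\<close>, the complete levels in between and
  the beginning of level \<open>l\<close>. The passage from the last index of a level to the first index of the next level is
  not paid for by a decay, which accounts for the division by \<open>\<sigma>\<close> in the constant.\<close>

lemma linear_convergence:
  assumes idx: "(l, k) \<in> index_set kk" "(l', k') \<in> index_set kk"
    and le: "step_count kk l' k' \<le> step_count kk l k"
  shows "e l k + h l k
    \<le> linear_const * \<sigma> ^ (step_count kk l k - step_count kk l' k') * (e l' k' + h l' k')"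
proof -
  note facts = q cs lam qth cr rec
  let ?H = "e l' k' + h l' k'" and ?n = "step_count kk l k - step_count kk l' k'"
  have H: "0 \<le> ?H" using rec_nonneg(1,2)[OF facts, of l' k'] by simp
  have pos: "1 \<le> Lc" "0 < Jc" "0 < lo" "0 < up"
    by (rule level_const_ge[OF facts] jump_const_pos[OF facts] equivalence_consts_pos[OF facts])+
  have reached: "level_reached kk l" "level_reached kk l'" and k: "enat k \<le> kk l" "enat k' \<le> kk l'"
    using idx by (auto simp: index_set_def)
  consider "l' = l" "k' \<le> k" | "l' < l" using step_count_le_imp_lex[OF idx le] by blast
  then show ?thesis
  proof cases
    case 1
    then have n: "?n = k - k'" unfolding step_count_eq[OF idx(1)] step_count_eq[OF idx(2)] by simp
    have "e l k + h l k \<le> Lc * q ^ (k - k') * ?H"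
      using decay_on_level[OF facts reached(1) k(1) 1(2)] 1 by simp
    also have "\<dots> \<le> Lc * \<sigma> ^ ?n * ?H"
      unfolding n using q \<sigma> pos H by (intro mult_right_mono mult_left_mono power_mono) auto
    also have "\<dots> \<le> linear_const * \<sigma> ^ ?n * ?H"
      using pos \<sigma> H unfolding linear_const_def by (intro mult_right_mono) auto
    finally show ?thesis .
  next
    case 2
    then obtain i where i: "l = Suc i" "l' \<le> i" by (cases l) auto
    have ri: "level_reached kk i" using reached(1) i by (auto intro: level_reached_mono)
    have fin: "kk i = enat (the_enat (kk i))" "kk l' = enat (the_enat (kk l'))"
      using reached(1) i unfolding level_reached_def
      by (metis the_enat.simps not_infinity_eq lessI, metis the_enat.simps not_infinity_eq less_Suc_eq_le)
    let ?m = "the_enat (kk l')" and ?p = "steps_before kk l - steps_before kk (Suc l')"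
    have k': "k' \<le> ?m" by (rule index_last_le[OF idx(2) fin(2)])
    have qs: "q ^ j \<le> \<sigma> ^ j" for j using q \<sigma> by (intro power_mono) auto
    have n: "?n = Suc (k + ?p + (?m - k'))"
      using k' steps_before_mono[of "Suc l'" l kk] 2
      by (simp add: step_count_eq[OF idx(1)] step_count_eq[OF idx(2)]) (simp add: steps_before_def)
    have "e l k + h l k \<le> Lc * Jc * lo * q ^ k * Y i"
      using quasi_error_across_level[OF facts ri fin(1)] idx i by simp
    also have "\<dots> \<le> Lc * Jc * lo * \<sigma> ^ k * (\<sigma> ^ ?p * Y l')"
      using lyapunov_chain[of l' i] reached(1) i pos q \<sigma> qs
      by (intro mult_mono) (auto simp: lyapunov_nonneg[OF facts])
    also have "\<dots> \<le> Lc * Jc * lo * \<sigma> ^ k * (\<sigma> ^ ?p * (up * (Lc * \<sigma> ^ (?m - k') * ?H)))"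
    proof (intro mult_left_mono)
      have "Y l' \<le> up * (e l' ?m + h l' ?m)"
        by (rule lyapunov_le_quasi_error[OF facts index_last[OF reached(2) fin(2)]])
      also have "e l' ?m + h l' ?m \<le> Lc * q ^ (?m - k') * ?H"
        by (rule decay_on_level[OF facts reached(2) _ k']) (use fin in simp)
      also have "\<dots> \<le> Lc * \<sigma> ^ (?m - k') * ?H"
        using pos H qs by (intro mult_right_mono mult_left_mono) auto
      finally show "Y l' \<le> up * (Lc * \<sigma> ^ (?m - k') * ?H)" using pos by simp
    qed (use pos \<sigma> in auto)
    also have "\<dots> = Lc * Jc * lo * up * Lc / \<sigma> * \<sigma> ^ ?n * ?H"
      unfolding n using \<sigma> by (simp add: power_add)
    also have "\<dots> \<le> linear_const * \<sigma> ^ ?n * ?H"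
      using pos \<sigma> H unfolding linear_const_def by (intro mult_right_mono) auto
    finally show ?thesis .
  qed
qed

end

text \<open>The constants depend on the parameters only and hence serve all runs simultaneously.\<close>

proposition quasi_error_recursion_linear_convergence:
  fixes q cs lam qth cr :: real
  assumes "0 < q" "q < 1" "0 < cs" "0 < lam" "0 < qth" "qth < 1" "0 < cr"
  obtains C \<sigma> where "0 < C" "0 < \<sigma>" "\<sigma> < 1"
    "\<And>kk e h z d l k l' k'. quasi_error_recursion q cs lam qth cr kk e h z d \<Longrightarrow>
       (l, k) \<in> index_set kk \<Longrightarrow> (l', k') \<in> index_set kk \<Longrightarrow>
       step_count kk l' k' \<le> step_count kk l k \<Longrightarrow>
       e l k + h l k \<le> C * \<sigma> ^ (step_count kk l k - step_count kk l' k') * (e l' k' + h l' k')"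
proof -
  \<comment> \<open>The positivity facts about the constants are stated relative to some recursion; the zero sequences provide one.\<close>
  have triv: "quasi_error_recursion q cs lam qth cr (\<lambda>_. \<infinity>) (\<lambda>_ _. 0) (\<lambda>_ _. 0) (\<lambda>_. 0) (\<lambda>_. 0)"
    by (simp add: quasi_error_recursion_def)
  note facts = assms triv
  obtain \<sigma> where \<sigma>: "0 < \<sigma>" "\<sigma> < 1" "q \<le> \<sigma>"
    "\<And>n. min (sqrt (lyapunov_rate q cs qth cr)) (level_rate_const q cs lam qth cr * q ^ n) \<le> \<sigma> ^ Suc n"
    using min_const_geometric_le_geometric[of "sqrt (lyapunov_rate q cs qth cr)" q "level_rate_const q cs lam qth cr"]
      parameters(6,7)[OF facts] level_rate_const_pos[OF facts] assms(1,2) by auto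
  have "0 < linear_const q cs lam qth cr \<sigma>"
    by (rule linear_const_pos[OF facts \<sigma>])
  then show ?thesis
    by (rule that[OF _ \<sigma>(1,2)]) (rule linear_convergence[OF assms _ \<sigma>])
qed

section \<open>The adaptive algorithm\<close>

text \<open>The part of the model problem that enters the analysis of a run. All constants of the convergence
  result must be chosen before the run, hence the run itself is fixed only in a context inside this
  locale.\<close>

locale adaptive_fem =
  fixes \<Omega> :: "(real^'n::finite) set"
    and A :: "real^'n \<Rightarrow> real^'n^'n"
    and f :: "real^'n \<Rightarrow> real"
    and ff :: "real^'n \<Rightarrow> real^'n"
    and \<T>\<^sub>0 :: "'n tagged_simplex set"
    and p :: nat
    and ustar :: "real^'n \<Rightarrow> real"
    and uH :: "'n tagged_simplex set \<Rightarrow> real^'n \<Rightarrow> real"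
    and \<Psi> :: "'n tagged_simplex set \<Rightarrow> ((real^'n \<Rightarrow> real) \<Rightarrow> real) \<Rightarrow> (real^'n \<Rightarrow> real) \<Rightarrow> (real^'n \<Rightarrow> real)"
    and q_alg C_stab C_rel q_red :: real
  assumes domain: "open \<Omega>" "bounded \<Omega>"
    and coefficient: "diffusion_coefficient \<Omega> A"
    and initial_mesh: "conforming_mesh \<Omega> \<T>\<^sub>0"
    and exact_solution: "galerkin_solution \<Omega> A (load_functional \<Omega> f ff) (H10 \<Omega>) ustar"
    and discrete_solution: "\<And>\<T>\<^sub>H. \<T>\<^sub>H \<in> refinements \<T>\<^sub>0 \<Longrightarrow>
      galerkin_solution \<Omega> A (load_functional \<Omega> f ff) (fe_space \<Omega> p \<T>\<^sub>H) (uH \<T>\<^sub>H)"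
    and q_alg: "0 < q_alg" "q_alg < 1"
    and solver_maps: "\<And>\<T>\<^sub>H v. \<T>\<^sub>H \<in> refinements \<T>\<^sub>0 \<Longrightarrow> v \<in> fe_space \<Omega> p \<T>\<^sub>H \<Longrightarrow>
      \<Psi> \<T>\<^sub>H (load_functional \<Omega> f ff) v \<in> fe_space \<Omega> p \<T>\<^sub>H"
    and solver_contracts: "\<And>\<T>\<^sub>H v. \<T>\<^sub>H \<in> refinements \<T>\<^sub>0 \<Longrightarrow> v \<in> fe_space \<Omega> p \<T>\<^sub>H \<Longrightarrow>
      energy_norm \<Omega> A (uH \<T>\<^sub>H - \<Psi> \<T>\<^sub>H (load_functional \<Omega> f ff) v)
        \<le> q_alg * energy_norm \<Omega> A (uH \<T>\<^sub>H - v)"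
    and constants: "0 < C_stab" "0 < C_rel" "0 < q_red" "q_red < 1"
    and stability: "\<And>\<T>\<^sub>H \<T>\<^sub>h \<U> v\<^sub>h v\<^sub>H. \<T>\<^sub>H \<in> refinements \<T>\<^sub>0 \<Longrightarrow> \<T>\<^sub>h \<in> refinements \<T>\<^sub>H \<Longrightarrow>
      v\<^sub>h \<in> fe_space \<Omega> p \<T>\<^sub>h \<Longrightarrow> v\<^sub>H \<in> fe_space \<Omega> p \<T>\<^sub>H \<Longrightarrow> \<U> \<subseteq> \<T>\<^sub>H \<inter> \<T>\<^sub>h \<Longrightarrow>
      \<bar>eta A f ff \<T>\<^sub>h \<U> v\<^sub>h - eta A f ff \<T>\<^sub>H \<U> v\<^sub>H\<bar> \<le> C_stab * energy_norm \<Omega> A (v\<^sub>h - v\<^sub>H)"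
    and reduction: "\<And>\<T>\<^sub>H \<T>\<^sub>h v\<^sub>H. \<T>\<^sub>H \<in> refinements \<T>\<^sub>0 \<Longrightarrow> \<T>\<^sub>h \<in> refinements \<T>\<^sub>H \<Longrightarrow>
      v\<^sub>H \<in> fe_space \<Omega> p \<T>\<^sub>H \<Longrightarrow>
      eta A f ff \<T>\<^sub>h (\<T>\<^sub>h - \<T>\<^sub>H) v\<^sub>H \<le> q_red * eta A f ff \<T>\<^sub>H (\<T>\<^sub>H - \<T>\<^sub>h) v\<^sub>H"
    and reliability: "\<And>\<T>\<^sub>H. \<T>\<^sub>H \<in> refinements \<T>\<^sub>0 \<Longrightarrow>
      energy_norm \<Omega> A (ustar - uH \<T>\<^sub>H) \<le> C_rel * eta A f ff \<T>\<^sub>H \<T>\<^sub>H (uH \<T>\<^sub>H)"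
begin

lemma meshes:
  assumes "\<T> \<in> refinements \<T>\<^sub>0"
  shows "finite \<T>" "\<forall>T\<in>\<T>. 2 \<le> length (fst T)"
proof -
  have "finite \<T>\<^sub>0" "\<forall>T\<in>\<T>\<^sub>0. 2 \<le> length (fst T)"
    using initial_mesh by (auto simp: conforming_mesh_def nondegenerate_def Suc_le_eq)
  with nvb_refinement_invariant(1,2)[OF refinements_nvb_refinement[OF assms]]
  show "finite \<T>" "\<forall>T\<in>\<T>. 2 \<le> length (fst T)" by blast+
qed

lemma nested:
  assumes "\<T> \<in> refinements \<T>\<^sub>0" "\<T>' \<in> refinements \<T>"
  shows "fe_space \<Omega> p \<T> \<subseteq> fe_space \<Omega> p \<T>'"
  by (rule fe_space_nested[OF nvb_refinement_invariant(3)[OF refinements_nvb_refinement[OF assms(2)] meshes[OF assms(1)]]])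

lemma discrete_solution_in_fe_space:
  "\<T> \<in> refinements \<T>\<^sub>0 \<Longrightarrow> uH \<T> \<in> fe_space \<Omega> p \<T>"
  using discrete_solution by (simp add: galerkin_solution_def)

lemma fe_in_H1: "v \<in> fe_space \<Omega> p \<T> \<Longrightarrow> v \<in> H1 \<Omega>"
  using fe_space_subset_H10 H10_subset_H1 by blast

lemma exact_in_H1: "ustar \<in> H1 \<Omega>"
  using exact_solution H10_subset_H1 by (auto simp: galerkin_solution_def)

lemmas triangle = energy_norm_triangle[OF domain coefficient]
lemmas norm_nonneg = energy_norm_nonneg[OF domain coefficient]
lemmas norm_commute = energy_norm_diff_commute[OF domain coefficient]

lemma estimator_reliable:
  assumes "\<T> \<in> refinements \<T>\<^sub>0" "v \<in> fe_space \<Omega> p \<T>"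
  shows "energy_norm \<Omega> A (ustar - uH \<T>)
    \<le> C_rel * (eta A f ff \<T> \<T> v + C_stab * energy_norm \<Omega> A (uH \<T> - v))"
proof -
  have "eta A f ff \<T> \<T> (uH \<T>) \<le> eta A f ff \<T> \<T> v + C_stab * energy_norm \<Omega> A (uH \<T> - v)"
    using stability[OF assms(1) refinements.refl discrete_solution_in_fe_space[OF assms(1)] assms(2), of \<T>]
    by (simp add: abs_le_iff)
  then have "C_rel * eta A f ff \<T> \<T> (uH \<T>) \<le> C_rel * (eta A f ff \<T> \<T> v + C_stab * energy_norm \<Omega> A (uH \<T> - v))"
    using constants by (intro mult_left_mono) auto
  with reliability[OF assms(1)] show ?thesis by linarith
qed

lemma quasi_error_dominates_error:
  assumes "\<T> \<in> refinements \<T>\<^sub>0" "v \<in> fe_space \<Omega> p \<T>"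
  shows "energy_norm \<Omega> A (ustar - v)
    \<le> (1 + C_rel * (1 + C_stab)) * (energy_norm \<Omega> A (uH \<T> - v) + eta A f ff \<T> \<T> v)"
proof -
  let ?e = "energy_norm \<Omega> A (uH \<T> - v)" and ?h = "eta A f ff \<T> \<T> v"
  have "energy_norm \<Omega> A (ustar - v) \<le> C_rel * (?h + C_stab * ?e) + ?e"
    using triangle[OF exact_in_H1 fe_in_H1[OF discrete_solution_in_fe_space[OF assms(1)]] fe_in_H1[OF assms(2)]]
      estimator_reliable[OF assms] by linarith
  also have "\<dots> \<le> C_rel * ((1 + C_stab) * (?e + ?h)) + (?e + ?h)"
    using constants norm_nonneg eta_nonneg[of A f ff \<T> \<T> v]
    by (intro add_mono mult_left_mono) (auto simp: algebra_simps)
  finally show ?thesis by (simp add: algebra_simps)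
qed

context
  fixes \<theta> lam :: real and \<T> \<M> :: "nat \<Rightarrow> 'n tagged_simplex set"
    and u :: "nat \<Rightarrow> nat \<Rightarrow> real^'n \<Rightarrow> real" and kk :: "nat \<Rightarrow> enat"
  assumes \<theta>: "0 < \<theta>" "\<theta> \<le> 1" and lam: "0 < lam"
    and run: "afem_run \<Omega> A f ff \<Psi> \<T>\<^sub>0 \<theta> lam \<T> \<M> u kk"
begin

lemma run_start: "\<T> 0 = \<T>\<^sub>0" "u 0 0 = (\<lambda>x. 0)"
  and run_solver: "level_reached kk l \<Longrightarrow> enat (Suc k) \<le> kk l \<Longrightarrow>
      u l (Suc k) = \<Psi> (\<T> l) (load_functional \<Omega> f ff) (u l k)"
  and run_stop: "level_reached kk l \<Longrightarrow> kk l = Inf (enat ` {k. 1 \<le> k \<and>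
      energy_norm \<Omega> A (u l k - u l (k - 1)) \<le> lam * eta A f ff (\<T> l) (\<T> l) (u l k)})"
  and run_mark: "level_reached kk l \<Longrightarrow> kk l = enat m \<Longrightarrow>
      doerfler_marking \<theta> (\<T> l) (\<lambda>\<U>. eta A f ff (\<T> l) \<U> (u l m)) (\<M> l)"
  and run_refine: "level_reached kk l \<Longrightarrow> kk l = enat m \<Longrightarrow> is_refine (\<T> l) (\<M> l) (\<T> (Suc l))"
  and run_nested_iteration: "level_reached kk l \<Longrightarrow> kk l = enat m \<Longrightarrow> u (Suc l) 0 = u l m"
  using run unfolding afem_run_def by blast+

lemma next_mesh:
  assumes "level_reached kk l" "kk l = enat m"
  shows "\<T> (Suc l) \<in> refinements (\<T> l)" "\<M> l \<inter> \<T> (Suc l) = {}"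
proof -
  note m = run_mark[OF assms] run_refine[OF assms]
  then have "\<M> l \<subseteq> \<T> l" by (simp add: doerfler_marking_def)
  then show "\<T> (Suc l) \<in> refinements (\<T> l)"
    using m by (intro refinements.step[OF refinements.refl])
  show "\<M> l \<inter> \<T> (Suc l) = {}" using m by (simp add: is_refine_def conforming_refinements_def)
qed

lemma run_well_defined:
  "level_reached kk l \<Longrightarrow> \<T> l \<in> refinements \<T>\<^sub>0 \<and> (\<forall>k. enat k \<le> kk l \<longrightarrow> u l k \<in> fe_space \<Omega> p (\<T> l))"
proof (induction l)
  case (0)
  have mesh: "\<T> 0 \<in> refinements \<T>\<^sub>0" by (simp add: run_start refinements.refl)
  moreover have "enat k \<le> kk 0 \<longrightarrow> u 0 k \<in> fe_space \<Omega> p (\<T> 0)" for k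
  proof (induction k)
    case 0
    show ?case by (simp add: run_start zero_in_fe_space[OF domain])
  next
    case (Suc k)
    then show ?case
      using run_solver[OF \<open>level_reached kk 0\<close>, of k] solver_maps[OF mesh] by (auto simp: Suc_ile_eq)
  qed
  ultimately show ?case by blast
next
  case (Suc l)
  have reached: "level_reached kk l" by (rule level_reached_mono[OF Suc.prems]) simp
  obtain m where m: "kk l = enat m" using Suc.prems by (auto simp: level_reached_def)
  note IH = Suc.IH[OF reached]
  have mesh: "\<T> (Suc l) \<in> refinements \<T>\<^sub>0"
    using IH run_mark[OF reached m] run_refine[OF reached m]
    by (auto simp: doerfler_marking_def intro: refinements.step)
  moreover have "enat k \<le> kk (Suc l) \<longrightarrow> u (Suc l) k \<in> fe_space \<Omega> p (\<T> (Suc l))" for k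
  proof (induction k)
    case 0
    show ?case
      using IH nested[OF _ next_mesh(1)[OF reached m]] m by (auto simp: run_nested_iteration[OF reached m])
  next
    case (Suc k)
    then show ?case
      using run_solver[OF \<open>level_reached kk (Suc l)\<close>, of k] solver_maps[OF mesh] by (auto simp: Suc_ile_eq)
  qed
  ultimately show ?case by blast
qed

lemma run_mesh: "level_reached kk l \<Longrightarrow> \<T> l \<in> refinements \<T>\<^sub>0"
  and run_iterate: "(l, k) \<in> index_set kk \<Longrightarrow> u l k \<in> fe_space \<Omega> p (\<T> l)"
  using run_well_defined by (auto simp: index_set_def)

lemma run_at_least_one_step:
  assumes "level_reached kk l" shows "1 \<le> kk l"
  unfolding run_stop[OF assms] by (rule Inf_greatest) (auto simp: one_enat_def)

lemma run_estimator_before_stop: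
  assumes "level_reached kk l" "enat (Suc k) < kk l"
  shows "lam * eta A f ff (\<T> l) (\<T> l) (u l (Suc k)) \<le> energy_norm \<Omega> A (u l (Suc k) - u l k)"
proof (rule ccontr)
  assume "\<not> ?thesis"
  then have "enat (Suc k) \<in> enat ` {k. 1 \<le> k \<and>
      energy_norm \<Omega> A (u l k - u l (k - 1)) \<le> lam * eta A f ff (\<T> l) (\<T> l) (u l k)}" by auto
  then have "kk l \<le> enat (Suc k)" unfolding run_stop[OF assms(1)] by (rule Inf_lower)
  with assms(2) show False by simp
qed

text \<open>Here the axioms of the estimator, the solver and the Galerkin method enter; everything else about the
  convergence of the run is a consequence of this recursion.\<close>

lemma run_quasi_error_recursion:
  "quasi_error_recursion q_alg C_stab lam (sqrt (1 - (1 - q_red\<^sup>2) * \<theta>)) C_rel kk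
     (\<lambda>l k. energy_norm \<Omega> A (uH (\<T> l) - u l k)) (\<lambda>l k. eta A f ff (\<T> l) (\<T> l) (u l k))
     (\<lambda>l. energy_norm \<Omega> A (ustar - uH (\<T> l))) (\<lambda>l. energy_norm \<Omega> A (uH (\<T> (Suc l)) - uH (\<T> l)))"
  unfolding quasi_error_recursion_def
proof (intro conjI allI impI; (elim conjE)?)
  fix l k j
  assume idx: "(l, k) \<in> index_set kk" "(l, j) \<in> index_set kk"
  have reached: "level_reached kk l" using idx by (simp add: index_set_def)
  note mesh = run_mesh[OF reached] and it = run_iterate[OF idx(1)] run_iterate[OF idx(2)]
  note sol = discrete_solution_in_fe_space[OF mesh]
  have "eta A f ff (\<T> l) (\<T> l) (u l k) \<le> eta A f ff (\<T> l) (\<T> l) (u l j) + C_stab * energy_norm \<Omega> A (u l k - u l j)"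
    using stability[OF mesh refinements.refl it, of "\<T> l"] by (simp add: abs_le_iff)
  also have "C_stab * energy_norm \<Omega> A (u l k - u l j)
      \<le> C_stab * (energy_norm \<Omega> A (uH (\<T> l) - u l k) + energy_norm \<Omega> A (uH (\<T> l) - u l j))"
    using triangle[OF fe_in_H1[OF it(1)] fe_in_H1[OF sol] fe_in_H1[OF it(2)]]
      norm_commute[OF fe_in_H1[OF it(1)] fe_in_H1[OF sol]] constants
    by (intro mult_left_mono) auto
  finally show "eta A f ff (\<T> l) (\<T> l) (u l k) \<le> eta A f ff (\<T> l) (\<T> l) (u l j) +
      C_stab * (energy_norm \<Omega> A (uH (\<T> l) - u l k) + energy_norm \<Omega> A (uH (\<T> l) - u l j))" by simp
next
  fix l k assume l: "level_reached kk l" "enat (Suc k) \<le> kk l"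
  then have "(l, k) \<in> index_set kk" by (auto simp: index_set_def Suc_ile_eq)
  from solver_contracts[OF run_mesh[OF l(1)] run_iterate[OF this]]
  show "energy_norm \<Omega> A (uH (\<T> l) - u l (Suc k)) \<le> q_alg * energy_norm \<Omega> A (uH (\<T> l) - u l k)"
    by (simp add: run_solver[OF l])
next
  fix l k assume l: "level_reached kk l" "enat (Suc k) < kk l"
  have "enat k \<le> kk l" "enat (Suc k) \<le> kk l"
    using less_imp_le[OF l(2)] by (simp_all add: Suc_ile_eq)
  with l(1) have "(l, k) \<in> index_set kk" "(l, Suc k) \<in> index_set kk"
    by (simp_all add: index_set_def)
  note it = this[THEN run_iterate, THEN fe_in_H1]
  note sol = fe_in_H1[OF discrete_solution_in_fe_space[OF run_mesh[OF l(1)]]]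
  show "lam * eta A f ff (\<T> l) (\<T> l) (u l (Suc k))
      \<le> energy_norm \<Omega> A (uH (\<T> l) - u l (Suc k)) + energy_norm \<Omega> A (uH (\<T> l) - u l k)"
    using run_estimator_before_stop[OF l] triangle[OF it(2) sol it(1)] norm_commute[OF it(2) sol] by linarith
next
  fix l m assume l: "level_reached kk l" "kk l = enat m"
  have reached: "level_reached kk (Suc l)" using l by (auto simp: level_reached_def less_Suc_eq)
  note mesh = run_mesh[OF l(1)] run_mesh[OF reached] and nxt = next_mesh[OF l]
  note it = run_iterate[OF index_last[OF l]]
  note sol = discrete_solution_in_fe_space[OF mesh(1)] discrete_solution_in_fe_space[OF mesh(2)]
  note nest = nested[OF mesh(1) nxt(1)]
  show "energy_norm \<Omega> A (uH (\<T> (Suc l)) - u (Suc l) 0)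
      \<le> energy_norm \<Omega> A (uH (\<T> l) - u l m) + energy_norm \<Omega> A (uH (\<T> (Suc l)) - uH (\<T> l))"
    using triangle[OF fe_in_H1[OF sol(2)] fe_in_H1[OF sol(1)] fe_in_H1[OF it]]
    by (simp add: run_nested_iteration[OF l])
  have "eta A f ff (\<T> (Suc l)) (\<T> l \<inter> \<T> (Suc l)) (u l m) = eta A f ff (\<T> l) (\<T> l \<inter> \<T> (Suc l)) (u l m)"
    using stability[OF mesh(1) nxt(1) subsetD[OF nest it] it subset_refl]
    by (simp add: energy_norm_diff_self[OF domain coefficient fe_in_H1[OF it]])
  from doerfler_reduction[OF meshes(1)[OF mesh(1)] meshes(1)[OF mesh(2)] this
      reduction[OF mesh(1) nxt(1) it] constants(3,4) \<theta>(2) run_mark[OF l] nxt(2)]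
  show "eta A f ff (\<T> (Suc l)) (\<T> (Suc l)) (u (Suc l) 0)
      \<le> sqrt (1 - (1 - q_red\<^sup>2) * \<theta>) * eta A f ff (\<T> l) (\<T> l) (u l m)"
    by (simp add: run_nested_iteration[OF l])
  show "(energy_norm \<Omega> A (ustar - uH (\<T> (Suc l))))\<^sup>2 + (energy_norm \<Omega> A (uH (\<T> (Suc l)) - uH (\<T> l)))\<^sup>2
      = (energy_norm \<Omega> A (ustar - uH (\<T> l)))\<^sup>2"
    by (rule galerkin_pythagoras[OF domain coefficient exact_solution discrete_solution[OF mesh(2)]
        discrete_solution[OF mesh(1)] nest]) (auto simp: fe_space_subset_H10 H10_subset_H1)
next
  fix l k assume "(l, k) \<in> index_set kk"
  then show "energy_norm \<Omega> A (ustar - uH (\<T> l)) \<le> C_rel * (eta A f ff (\<T> l) (\<T> l) (u l k)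
      + C_stab * energy_norm \<Omega> A (uH (\<T> l) - u l k))"
    by (intro estimator_reliable run_mesh run_iterate) (auto simp: index_set_def)
qed (rule norm_nonneg eta_nonneg run_at_least_one_step; assumption?)+

end

end

lemma geometric_tendsto_steps_at_top:
  fixes q :: real
  assumes "0 < q" "q < 1"
  shows "((\<lambda>(l, k). c * q ^ step_count kk l k * d) \<longlongrightarrow> 0) (steps_at_top kk)"
proof -
  have "filterlim (\<lambda>(l, k). step_count kk l k) at_top (steps_at_top kk)"
    unfolding steps_at_top_def by (rule filterlim_mono[OF filterlim_filtercomap order_refl inf_le1])
  moreover have "(\<lambda>n. c * q ^ n * d) \<longlonglongrightarrow> c * 0 * d"
    by (intro tendsto_intros LIMSEQ_realpow_zero) (use assms in auto)
  ultimately have "((\<lambda>x. c * q ^ (case x of (l, k) \<Rightarrow> step_count kk l k) * d) \<longlongrightarrow> c * 0 * d) (steps_at_top kk)"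
    by (rule filterlim_compose[rotated])
  then show ?thesis by (simp add: case_prod_unfold)
qed

lemma eventually_steps_at_top:
  assumes "\<And>l k. (l, k) \<in> index_set kk \<Longrightarrow> P (l, k)"
  shows "eventually P (steps_at_top kk)"
  unfolding steps_at_top_def eventually_inf_principal using assms by (intro always_eventually) auto

theorem theorem5:
  fixes \<Omega> :: "(real^'n::finite) set"
    and A :: "real^'n \<Rightarrow> real^'n^'n"
    and f :: "real^'n \<Rightarrow> real"
    and ff :: "real^'n \<Rightarrow> real^'n"
    and \<T>\<^sub>0 :: "'n tagged_simplex set"
    and p :: nat
    and ustar :: "real^'n \<Rightarrow> real"
    and uH :: "'n tagged_simplex set \<Rightarrow> real^'n \<Rightarrow> real"
    and \<Psi> :: "'n tagged_simplex set \<Rightarrow> ((real^'n \<Rightarrow> real) \<Rightarrow> real) \<Rightarrow> (real^'n \<Rightarrow> real) \<Rightarrow> (real^'n \<Rightarrow> real)"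
    and q_alg C_stab C_rel C_drel q_red :: real
  assumes domain: "polytopal_lipschitz_domain \<Omega>"
    and coefficient: "diffusion_coefficient \<Omega> A"
    and load: "f \<in> L2 \<Omega>" "ff \<in> L2 \<Omega>"
    and initial_mesh: "conforming_mesh \<Omega> \<T>\<^sub>0" "nvb_admissible \<T>\<^sub>0"
    and piecewise_lipschitz: "lipschitz_on_elements \<T>\<^sub>0 A" "lipschitz_on_elements \<T>\<^sub>0 ff"
    and degree: "1 \<le> p"
    and exact_solution: "galerkin_solution \<Omega> A (load_functional \<Omega> f ff) (H10 \<Omega>) ustar"
    and discrete_solution: "\<And>\<T>\<^sub>H. \<T>\<^sub>H \<in> refinements \<T>\<^sub>0 \<Longrightarrow>
      galerkin_solution \<Omega> A (load_functional \<Omega> f ff) (fe_space \<Omega> p \<T>\<^sub>H) (uH \<T>\<^sub>H)"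
    and q_alg: "0 < q_alg" "q_alg < 1"
    and solver_maps: "\<And>\<T>\<^sub>H v. \<T>\<^sub>H \<in> refinements \<T>\<^sub>0 \<Longrightarrow> v \<in> fe_space \<Omega> p \<T>\<^sub>H \<Longrightarrow>
      \<Psi> \<T>\<^sub>H (load_functional \<Omega> f ff) v \<in> fe_space \<Omega> p \<T>\<^sub>H"
    and solver_contracts: "\<And>\<T>\<^sub>H v. \<T>\<^sub>H \<in> refinements \<T>\<^sub>0 \<Longrightarrow> v \<in> fe_space \<Omega> p \<T>\<^sub>H \<Longrightarrow>
      energy_norm \<Omega> A (uH \<T>\<^sub>H - \<Psi> \<T>\<^sub>H (load_functional \<Omega> f ff) v)
        \<le> q_alg * energy_norm \<Omega> A (uH \<T>\<^sub>H - v)"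
    and constants: "0 < C_stab" "0 < C_rel" "0 < C_drel" "0 < q_red" "q_red < 1"
    and A1: "\<And>\<T>\<^sub>H \<T>\<^sub>h \<U> v\<^sub>h v\<^sub>H. \<T>\<^sub>H \<in> refinements \<T>\<^sub>0 \<Longrightarrow> \<T>\<^sub>h \<in> refinements \<T>\<^sub>H \<Longrightarrow>
      v\<^sub>h \<in> fe_space \<Omega> p \<T>\<^sub>h \<Longrightarrow> v\<^sub>H \<in> fe_space \<Omega> p \<T>\<^sub>H \<Longrightarrow> \<U> \<subseteq> \<T>\<^sub>H \<inter> \<T>\<^sub>h \<Longrightarrow>
      \<bar>eta A f ff \<T>\<^sub>h \<U> v\<^sub>h - eta A f ff \<T>\<^sub>H \<U> v\<^sub>H\<bar> \<le> C_stab * energy_norm \<Omega> A (v\<^sub>h - v\<^sub>H)"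
    and A2: "\<And>\<T>\<^sub>H \<T>\<^sub>h v\<^sub>H. \<T>\<^sub>H \<in> refinements \<T>\<^sub>0 \<Longrightarrow> \<T>\<^sub>h \<in> refinements \<T>\<^sub>H \<Longrightarrow>
      v\<^sub>H \<in> fe_space \<Omega> p \<T>\<^sub>H \<Longrightarrow>
      eta A f ff \<T>\<^sub>h (\<T>\<^sub>h - \<T>\<^sub>H) v\<^sub>H \<le> q_red * eta A f ff \<T>\<^sub>H (\<T>\<^sub>H - \<T>\<^sub>h) v\<^sub>H"
    and A3: "\<And>\<T>\<^sub>H. \<T>\<^sub>H \<in> refinements \<T>\<^sub>0 \<Longrightarrow>
      energy_norm \<Omega> A (ustar - uH \<T>\<^sub>H) \<le> C_rel * eta A f ff \<T>\<^sub>H \<T>\<^sub>H (uH \<T>\<^sub>H)"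
    and A4: "\<And>\<T>\<^sub>H \<T>\<^sub>h. \<T>\<^sub>H \<in> refinements \<T>\<^sub>0 \<Longrightarrow> \<T>\<^sub>h \<in> refinements \<T>\<^sub>H \<Longrightarrow>
      energy_norm \<Omega> A (uH \<T>\<^sub>h - uH \<T>\<^sub>H) \<le> C_drel * eta A f ff \<T>\<^sub>H (\<T>\<^sub>H - \<T>\<^sub>h) (uH \<T>\<^sub>H)"
  shows "\<exists>C>0. \<forall>\<theta> lam :: real. 0 < \<theta> \<and> \<theta> \<le> 1 \<and> 0 < lam \<longrightarrow>
    (\<exists>C_lin q_lin. 0 < C_lin \<and> 0 < q_lin \<and> q_lin < 1 \<and>
      (\<forall>\<T> \<M> u kk. afem_run \<Omega> A f ff \<Psi> \<T>\<^sub>0 \<theta> lam \<T> \<M> u kk \<longrightarrow>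
        (\<forall>(l, k)\<in>index_set kk. \<forall>(l', k')\<in>index_set kk. step_count kk l' k' < step_count kk l k \<longrightarrow>
           quasi_error \<Omega> A f ff uH \<T> u l k
             \<le> C_lin * q_lin ^ (step_count kk l k - step_count kk l' k')
                 * quasi_error \<Omega> A f ff uH \<T> u l' k') \<and>
        (\<forall>(l, k)\<in>index_set kk.
           energy_norm \<Omega> A (ustar - u l k) \<le> C * quasi_error \<Omega> A f ff uH \<T> u l k \<and>
           quasi_error \<Omega> A f ff uH \<T> u l k
             \<le> C_lin * q_lin ^ step_count kk l k * quasi_error \<Omega> A f ff uH \<T> u 0 0) \<and>
        ((\<lambda>(l, k). C_lin * q_lin ^ step_count kk l k * quasi_error \<Omega> A f ff uH \<T> u 0 0) \<longlongrightarrow> 0)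
          (steps_at_top kk) \<and>
        ((\<lambda>(l, k). quasi_error \<Omega> A f ff uH \<T> u l k) \<longlongrightarrow> 0) (steps_at_top kk) \<and>
        ((\<lambda>(l, k). energy_norm \<Omega> A (ustar - u l k)) \<longlongrightarrow> 0) (steps_at_top kk)))"
proof -
  have "open \<Omega>" "bounded \<Omega>" using domain by (simp_all add: polytopal_lipschitz_domain_def)
  note pos = constants
  interpret adaptive_fem \<Omega> A f ff \<T>\<^sub>0 p ustar uH \<Psi> q_alg C_stab C_rel q_red
    by unfold_locales (fact \<open>open \<Omega>\<close> \<open>bounded \<Omega>\<close> assms)+
  define C where "C = 1 + C_rel * (1 + C_stab)"
  have "0 < C" using pos by (simp add: C_def add_pos_pos)
  show ?thesis
  proof (rule exI[of _ C], intro conjI allI impI \<open>0 < C\<close>, elim conjE)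
    fix \<theta> lam :: real assume \<theta>: "0 < \<theta>" "\<theta> \<le> 1" and lam: "0 < lam"
    let ?q\<theta> = "sqrt (1 - (1 - q_red\<^sup>2) * \<theta>)"
    have "q_red\<^sup>2 < 1" "0 < q_red\<^sup>2" using pos(4,5) by (simp_all add: abs_square_less_1)
    then have "0 < (1 - q_red\<^sup>2) * \<theta>" using \<theta> by simp
    moreover have "(1 - q_red\<^sup>2) * \<theta> < 1"
    proof -
      have "(1 - q_red\<^sup>2) * \<theta> \<le> (1 - q_red\<^sup>2) * 1"
        using \<theta> \<open>q_red\<^sup>2 < 1\<close> by (intro mult_left_mono) auto
      also have "\<dots> < 1" using \<open>0 < q_red\<^sup>2\<close> by simp
      finally show ?thesis .
    qed
    ultimately have q\<theta>: "0 < ?q\<theta>" "?q\<theta> < 1" by simp_all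
    obtain K \<sigma> where K: "0 < K" and \<sigma>: "0 < \<sigma>" "\<sigma> < 1" and conv:
      "\<And>kk e h z d l k l' k'. quasi_error_recursion q_alg C_stab lam ?q\<theta> C_rel kk e h z d \<Longrightarrow>
       (l, k) \<in> index_set kk \<Longrightarrow> (l', k') \<in> index_set kk \<Longrightarrow>
       step_count kk l' k' \<le> step_count kk l k \<Longrightarrow>
       e l k + h l k \<le> K * \<sigma> ^ (step_count kk l k - step_count kk l' k') * (e l' k' + h l' k')"
      by (rule quasi_error_recursion_linear_convergence[OF q_alg pos(1) lam q\<theta> pos(2)]) blast
    show "\<exists>C_lin q_lin. 0 < C_lin \<and> 0 < q_lin \<and> q_lin < 1 \<and>
      (\<forall>\<T> \<M> u kk. afem_run \<Omega> A f ff \<Psi> \<T>\<^sub>0 \<theta> lam \<T> \<M> u kk \<longrightarrow>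
        (\<forall>(l, k)\<in>index_set kk. \<forall>(l', k')\<in>index_set kk. step_count kk l' k' < step_count kk l k \<longrightarrow>
           quasi_error \<Omega> A f ff uH \<T> u l k
             \<le> C_lin * q_lin ^ (step_count kk l k - step_count kk l' k')
                 * quasi_error \<Omega> A f ff uH \<T> u l' k') \<and>
        (\<forall>(l, k)\<in>index_set kk.
           energy_norm \<Omega> A (ustar - u l k) \<le> C * quasi_error \<Omega> A f ff uH \<T> u l k \<and>
           quasi_error \<Omega> A f ff uH \<T> u l k
             \<le> C_lin * q_lin ^ step_count kk l k * quasi_error \<Omega> A f ff uH \<T> u 0 0) \<and>
        ((\<lambda>(l, k). C_lin * q_lin ^ step_count kk l k * quasi_error \<Omega> A f ff uH \<T> u 0 0) \<longlongrightarrow> 0)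
          (steps_at_top kk) \<and>
        ((\<lambda>(l, k). quasi_error \<Omega> A f ff uH \<T> u l k) \<longlongrightarrow> 0) (steps_at_top kk) \<and>
        ((\<lambda>(l, k). energy_norm \<Omega> A (ustar - u l k)) \<longlongrightarrow> 0) (steps_at_top kk))"
    proof (rule exI[of _ "K / \<sigma>"], rule exI[of _ \<sigma>], intro conjI[of "0 < K / \<sigma>"] conjI[OF \<sigma>(1)] conjI[OF \<sigma>(2)] allI impI)
      show "0 < K / \<sigma>" using K \<sigma> by simp
      fix \<T> \<M> u kk assume run: "afem_run \<Omega> A f ff \<Psi> \<T>\<^sub>0 \<theta> lam \<T> \<M> u kk"
      let ?H = "quasi_error \<Omega> A f ff uH \<T> u" and ?n = "step_count kk"
      have H_nonneg: "0 \<le> ?H l k" for l k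
        by (simp add: quasi_error_def norm_nonneg eta_nonneg)
      have lin: "?H l k \<le> K * \<sigma> ^ (?n l k - ?n l' k') * ?H l' k'"
        if "(l, k) \<in> index_set kk" "(l', k') \<in> index_set kk" "?n l' k' \<le> ?n l k" for l k l' k'
        unfolding quasi_error_def by (rule conv[OF run_quasi_error_recursion[OF \<theta> lam run] that])
      have "K \<le> K / \<sigma>" using K \<sigma> by (simp add: field_simps)
      have 1: "?H l k \<le> K / \<sigma> * \<sigma> ^ (?n l k - ?n l' k') * ?H l' k'"
        if "(l, k) \<in> index_set kk" "(l', k') \<in> index_set kk" "?n l' k' < ?n l k" for l k l' k'
      proof -
        \<comment> \<open>The larger constant \<open>K / \<sigma>\<close> is needed for the comparison with the initial quasi-error below.\<close>
        have "K * \<sigma> ^ (?n l k - ?n l' k') * ?H l' k' \<le> K / \<sigma> * \<sigma> ^ (?n l k - ?n l' k') * ?H l' k'"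
          using \<open>K \<le> K / \<sigma>\<close> \<sigma> H_nonneg by (intro mult_right_mono) auto
        with lin[OF that(1,2)] that(3) show ?thesis by linarith
      qed
      have 2: "energy_norm \<Omega> A (ustar - u l k) \<le> C * ?H l k" if "(l, k) \<in> index_set kk" for l k
        unfolding C_def quasi_error_def using that
        by (intro quasi_error_dominates_error run_mesh[OF \<theta> lam run] run_iterate[OF \<theta> lam run])
          (auto simp: index_set_def)
      have start: "(0, 0) \<in> index_set kk" by (simp add: index_set_def level_reached_def zero_enat_def[symmetric])
      \<comment> \<open>The first index has step count one, which costs one power of \<open>\<sigma>\<close> in the comparison with the initial quasi-error.\<close>
      have n_start: "?n 0 0 = 1" by (simp add: step_count_eq[OF start] steps_before_def)
      have 3: "?H l k \<le> K / \<sigma> * \<sigma> ^ ?n l k * ?H 0 0" if "(l, k) \<in> index_set kk" for l k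
      proof -
        have n: "?n l k = Suc (?n l k - 1)" by (simp add: step_count_eq[OF that])
        have "?H l k \<le> K * \<sigma> ^ (?n l k - 1) * ?H 0 0"
          using lin[OF that start] n n_start by simp
        also have "K * \<sigma> ^ (?n l k - 1) = K / \<sigma> * \<sigma> ^ ?n l k"
          by (subst (2) n) (use \<sigma> in simp)
        finally show ?thesis .
      qed
      have lim: "((\<lambda>(l, k). K / \<sigma> * \<sigma> ^ ?n l k * ?H 0 0) \<longlongrightarrow> 0) (steps_at_top kk)"
        by (rule geometric_tendsto_steps_at_top[OF \<sigma>])
      have limH: "((\<lambda>(l, k). ?H l k) \<longlongrightarrow> 0) (steps_at_top kk)"
        by (rule tendsto_sandwich[OF _ _ tendsto_const lim];
            rule eventually_steps_at_top) (use 3 in \<open>simp_all add: H_nonneg\<close>)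
      then have "((\<lambda>x. C * (case x of (l, k) \<Rightarrow> ?H l k)) \<longlongrightarrow> C * 0) (steps_at_top kk)"
        by (intro tendsto_intros)
      then have limC: "((\<lambda>(l, k). C * ?H l k) \<longlongrightarrow> 0) (steps_at_top kk)"
        by (simp add: case_prod_unfold)
      have limu: "((\<lambda>(l, k). energy_norm \<Omega> A (ustar - u l k)) \<longlongrightarrow> 0) (steps_at_top kk)"
        by (rule tendsto_sandwich[OF _ _ tendsto_const limC];
            rule eventually_steps_at_top) (auto simp: norm_nonneg 2)
      from 1 2 3 lim limH limu
      show "(\<forall>(l, k)\<in>index_set kk. \<forall>(l', k')\<in>index_set kk. step_count kk l' k' < step_count kk l k \<longrightarrow>
           quasi_error \<Omega> A f ff uH \<T> u l k
             \<le> K / \<sigma> * \<sigma> ^ (step_count kk l k - step_count kk l' k')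
                 * quasi_error \<Omega> A f ff uH \<T> u l' k') \<and>
        (\<forall>(l, k)\<in>index_set kk.
           energy_norm \<Omega> A (ustar - u l k) \<le> C * quasi_error \<Omega> A f ff uH \<T> u l k \<and>
           quasi_error \<Omega> A f ff uH \<T> u l k
             \<le> K / \<sigma> * \<sigma> ^ step_count kk l k * quasi_error \<Omega> A f ff uH \<T> u 0 0) \<and>
        ((\<lambda>(l, k). K / \<sigma> * \<sigma> ^ step_count kk l k * quasi_error \<Omega> A f ff uH \<T> u 0 0) \<longlongrightarrow> 0)
          (steps_at_top kk) \<and>
        ((\<lambda>(l, k). quasi_error \<Omega> A f ff uH \<T> u l k) \<longlongrightarrow> 0) (steps_at_top kk) \<and>
        ((\<lambda>(l, k). energy_norm \<Omega> A (ustar - u l k)) \<longlongrightarrow> 0) (steps_at_top kk)" by blast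
    qed
  qed
qed

end
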